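(* Let $\beta$ be a real nonzero number, let $\mu_1<\mu_2<\dots<\mu_{n-1}$ be distinct real numbers, and let $\{\lambda_j\}_{j=1}^{n}$ be a set of complex numbers in the closed upper half-plane, $\operatorname{Im}\lambda_j\ge0$ for $j=1,\dots,n$. Put $\chi_n(\lambda)=\prod_{j=1}^n(\lambda-\lambda_j)$. Then there exists a matrix $\widehat{J}_n$ in the class $\widehat{\mathcal{J}}_n$ with $\operatorname{Im}\widehat{a}_n>0$ and $\widehat{b}_1\widehat b_2\cdots\widehat{b}_n=\beta$ such that the spectrum of $\widehat{J}_n$ is $\{\lambda_1,\dots,\lambda_n\}$ and the spectrum of its leading principal $(n-1)\times(n-1)$ submatrix $\widehat{J}_{n-1}$ is $\{\mu_1,\dots,\mu_{n-1}\}$, if and only if $$\text{(i)}\ \ (-1)^{n-k}\chi_n(\mu_k)\ge0,\qquad k=1,\dots,n-1,$$ and $$\text{(ii)}\ \ |\chi_n(\mu_k)|\ge4(-1)^{n-k-1}\beta,\qquad k=1,\dots,n-1$$ (condition (i) includes the requirement that $\chi_n(\mu_k)$ is real). Moreover, if there are exactly $m_1$ equalities in (i) and exactly $m_2$ equalities in (ii) $(0\le m_1+m_2\le n-1)$, then there exist exactly $2^{n-m_1-m_2-1}$ matrices in the class $\widehat{\mathcal{J}}_n$ with these spectral data (the spectrum $\{\lambda_j\}$ of the matrix, the spectrum $\{\mu_k\}$ of its leading principal $(n-1)\times(n-1)$ submatrix, and the number $\beta=\widehat b_1\cdots\widehat b_n$).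
   Context: $\widehat{\mathcal{J}}_n$ is the class of complex $n\times n$ matrices $$\widehat{J}_n=\begin{pmatrix} \widehat{c}_1 & \widehat{b}_1 & 0 &\dots& 0 & \overline{\widehat{b}}_n\\ \widehat{b}_1 & \widehat{c}_2 & \widehat{b}_2 &\dots& 0 & 0\\ 0 & \widehat{b}_2 & \widehat{c}_3 &\dots& 0 & 0\\ \vdots&\vdots&\vdots&\ddots&\vdots&\vdots\\ 0&0&0&\dots&\widehat{c}_{n-1}&\widehat{b}_{n-1}\\ \widehat{b}_n&0&0&\dots&\widehat{b}_{n-1}&\widehat{a}_n \end{pmatrix},$$ i.e. the diagonal entries are $\widehat c_1,\dots,\widehat c_{n-1},\widehat a_n$; the $(k,k+1)$ and $(k+1,k)$ entries are $\widehat b_k$ for $k=1,\dots,n-1$; the $(1,n)$ entry is $\overline{\widehat b}_n$ and the $(n,1)$ entry is $\widehat b_n$; all other entries are $0$. Here $\widehat{c}_1,\dots,\widehat{c}_{n-1},\widehat{b}_1,\dots,\widehat{b}_{n-1}\in\mathbb{R}$, and $\widehat{a}_n,\widehat{b}_n\in\mathbb{C}$ with $\widehat{b}_n\ne0$.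
   Formalization: Here n ≥ 3; the equivalence also requires some Im λ_j > 0, as real λ_j force Im a_n = 0; matrices are counted up to conjugation by diag(±1,…,±1), equivalently with b_1,…,b_{n-1} > 0, as the literal count is 2^{n-1} times larger. *)

theory Defs
  imports
    "HOL-Analysis.Analysis"
    "Jordan_Normal_Form.Char_Poly"
begin

text \<open>
  The sequences of parameters are indexed from 1, matrix entries from 0: the entry of the
  mathematical text in row \<open>i\<close>, column \<open>j\<close> is \<open>J $$ (i - 1, j - 1)\<close>.
  The matrix has the displayed shape for \<open>n \<ge> 3\<close>; for smaller \<open>n\<close> the corner entries collide
  with the off-diagonal ones.
\<close>

definition hatJ_mat ::
    "nat \<Rightarrow> (nat \<Rightarrow> real) \<Rightarrow> (nat \<Rightarrow> real) \<Rightarrow> complex \<Rightarrow> complex \<Rightarrow> complex mat" where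
  "hatJ_mat n c b a bn = mat n n (\<lambda>(i, j).
     if i = j then (if i = n - 1 then a else complex_of_real (c (i + 1)))
     else if j = i + 1 then complex_of_real (b (i + 1))
     else if i = j + 1 then complex_of_real (b (j + 1))
     else if i = 0 \<and> j = n - 1 then cnj bn
     else if i = n - 1 \<and> j = 0 then bn
     else 0)"

definition hatJ_class :: "nat \<Rightarrow> complex mat set" where
  "hatJ_class n = {hatJ_mat n c b a bn | c b a bn. bn \<noteq> 0}"

text \<open>
  The parameters \<open>b\<^sub>k\<close> and \<open>a\<^sub>n\<close> read off from the matrix: \<open>b\<^sub>k\<close> is the \<open>(k, k + 1)\<close> entry for
  \<open>k < n\<close> and the lower left corner \<open>(n, 1)\<close> for \<open>k = n\<close>; the column index is \<open>k + 1\<close> modulo \<open>n\<close>.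
\<close>

definition hat_b :: "complex mat \<Rightarrow> nat \<Rightarrow> complex" where
  "hat_b J k = J $$ (k - 1, k mod dim_row J)"

definition hat_a :: "complex mat \<Rightarrow> complex" where
  "hat_a J = J $$ (dim_row J - 1, dim_row J - 1)"

lemma hat_b_hatJ_mat:
  assumes "n \<ge> 3"
  shows "1 \<le> k \<Longrightarrow> k < n \<Longrightarrow> hat_b (hatJ_mat n c b a bn) k = complex_of_real (b k)"
    and "hat_b (hatJ_mat n c b a bn) n = bn"
  using assms by (auto simp: hat_b_def hatJ_mat_def)

lemma hat_a_hatJ_mat:
  assumes "n \<ge> 3"
  shows "hat_a (hatJ_mat n c b a bn) = a"
  using assms by (auto simp: hat_a_def hatJ_mat_def)

definition leading_minor_mat :: "'a mat \<Rightarrow> 'a mat" where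
  "leading_minor_mat J = mat_delete J (dim_row J - 1) (dim_col J - 1)"

text \<open>Spectra are counted with algebraic multiplicity.\<close>

definition spectrum_mset :: "complex mat \<Rightarrow> complex multiset" where
  "spectrum_mset A = proots (char_poly A)"

definition hatJ_data ::
    "nat \<Rightarrow> (nat \<Rightarrow> complex) \<Rightarrow> (nat \<Rightarrow> real) \<Rightarrow> real \<Rightarrow> complex mat set" where
  "hatJ_data n lam mu \<beta> = {J \<in> hatJ_class n.
     spectrum_mset J = image_mset lam (mset_set {1..n}) \<and>
     spectrum_mset (leading_minor_mat J) =
       image_mset (\<lambda>k. complex_of_real (mu k)) (mset_set {1..n-1}) \<and>
     (\<Prod>k=1..n. hat_b J k) = complex_of_real \<beta>}"

definition chi :: "nat \<Rightarrow> (nat \<Rightarrow> complex) \<Rightarrow> complex \<Rightarrow> complex" where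
  "chi n lam z = (\<Prod>j=1..n. z - lam j)"

text \<open>
  Equality up to the signs of the off-diagonal parameters: conjugation by a diagonal matrix with
  diagonal entries \<open>\<plusminus>1\<close>. It replaces \<open>b\<^sub>k\<close> by \<open>s\<^sub>k s\<^sub>k\<^sub>+\<^sub>1 b\<^sub>k\<close> (cyclically), so it preserves the class,
  both spectra and the product of the \<open>b\<^sub>k\<close>. If all \<open>b\<^sub>k\<close> are nonzero and their product is real,
  every equivalence class in \<open>hatJ_class n\<close> has exactly one member with
  \<open>b\<^sub>1, \<dots>, b\<^sub>n\<^sub>-\<^sub>1 > 0\<close>.
\<close>

definition sign_similar :: "nat \<Rightarrow> complex mat rel" where
  "sign_similar n = {(J, K). J \<in> carrier_mat n n \<and>
     (\<exists>s :: nat \<Rightarrow> complex. (\<forall>i<n. s i \<in> {1, -1}) \<and> K = mat_diag n s * J * mat_diag n s)}"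

end

theory Submission
  imports Defs
begin

text \<open>
  Put \<open>N = n - 1\<close> and let \<open>P\<close>, \<open>Q\<close>, \<open>R\<close> be the characteristic polynomials of the leading
  \<open>N \<times> N\<close> block and of this block without its first, respectively last, row and column. As \<open>\<beta>\<close>
  is real and nonzero, so is \<open>b\<^sub>n\<close>, and expanding the determinant along the border
  (\<open>det_corner_pencil\<close>) gives
  \[ \chi_n = (x - a)\,P - b_n^2\,Q - b_N^2\,R - 2\beta . \]
  At a zero \<open>mu k\<close> of \<open>P\<close> the entry \<open>a\<close> drops out, \<open>Q\<close> has the sign
  \<open>(-1)^(N - k)\<close> by interlacing (\<open>jacobi_poly_interlacing\<close>), and \<open>Q R = (b\<^sub>1 \<dots> b\<^sub>N\<^sub>-\<^sub>1)\<^sup>2\<close> by a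
  Casorati identity (\<open>jacobi_poly_casorati\<close>). Hence \<open>x\<^sub>k = \<bar>b\<^sub>n\<^sup>2 Q\<bar>\<close> and \<open>y\<^sub>k = \<bar>b\<^sub>N\<^sup>2 R\<bar>\<close>,
  taken at \<open>mu k\<close>, satisfy
  \[ x_k y_k = \beta^2, \qquad x_k + y_k = (-1)^{n-k}\chi_n(\mu_k) - 2(-1)^{N-k}\beta . \]
  Positive solutions exist iff the right side of the second equation is real and at least
  \<open>2 \<bar>\<beta>\<bar>\<close>. This is the conjunction of the two conditions of the theorem at \<open>mu k\<close>; there are two
  choices of \<open>x\<^sub>k\<close>, except that equality in one of the conditions leaves only one
  (\<open>node_weights_count\<close>).

  Conversely, any choice of weights \<open>x\<^sub>k\<close> comes from exactly one matrix with
  \<open>b\<^sub>1, \<dots>, b\<^sub>N > 0\<close> (\<open>bij_betw_weights_of\<close>). Indeed the \<open>x\<^sub>k\<close> determine \<open>b\<^sub>n\<^sup>2 Q\<close> by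
  interpolation, \<open>P\<close> and \<open>Q\<close> determine the block by Euclid's algorithm
  (\<open>jacobi_inverse_exists\<close>, \<open>jacobi_inverse_unique\<close>), \<open>b\<^sub>N\<close> comes from \<open>\<beta>\<close>, and
  \<open>a\<close> is a difference of traces (\<open>monic_eq_by_nodes_iff\<close>). The trace also shows that
  \<open>Im a\<close> is the sum of the \<open>Im (lam j)\<close>, so that \<open>Im a > 0\<close> means that the \<open>lam j\<close> are not all real.
  Finally every class of sign similar matrices with the given data contains exactly one with
  \<open>b\<^sub>1, \<dots>, b\<^sub>N > 0\<close>, because conjugation by signs adjusts the signs of these entries freely.
\<close>

section \<open>Determinants of bordered Jacobi matrices\<close>

text \<open>
  The characteristic polynomial of the Jacobi matrix with diagonal \<open>c\<^sub>i, \<dots>, c\<^sub>i\<^sub>+\<^sub>m\<^sub>-\<^sub>1\<close> and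
  off-diagonal entries \<open>b\<^sub>i, \<dots>, b\<^sub>i\<^sub>+\<^sub>m\<^sub>-\<^sub>2\<close>. The start index is a parameter because removing
  the first row and column, which is what both the recursion and the inverse problem do, shifts it.
\<close>
fun jacobi_poly :: "(nat \<Rightarrow> 'a::comm_ring_1) \<Rightarrow> (nat \<Rightarrow> 'a) \<Rightarrow> nat \<Rightarrow> nat \<Rightarrow> 'a poly" where
  "jacobi_poly c b i 0 = 1"
| "jacobi_poly c b i (Suc 0) = [:- c i, 1:]"
| "jacobi_poly c b i (Suc (Suc m)) =
     [:- c i, 1:] * jacobi_poly c b (Suc i) (Suc m)
       - Polynomial.smult ((b i)\<^sup>2) (jacobi_poly c b (Suc (Suc i)) m)"

definition jacobi_pencil :: "(nat \<Rightarrow> 'a::comm_ring_1) \<Rightarrow> (nat \<Rightarrow> 'a) \<Rightarrow> nat \<Rightarrow> nat \<Rightarrow> 'a poly mat" where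
  "jacobi_pencil c b i m = mat m m (\<lambda>(r, s).
     if r = s then [:- c (i + r), 1:]
     else if s = r + 1 then [:- b (i + r):]
     else if r = s + 1 then [:- b (i + s):]
     else 0)"

lemma det_first_column_sparse:
  assumes A: "A \<in> carrier_mat m m" and "m \<ge> 2"
    and 0: "\<And>r. 2 \<le> r \<Longrightarrow> r < m \<Longrightarrow> A $$ (r, 0) = 0"
  shows "det A = A $$ (0, 0) * det (mat_delete A 0 0) - A $$ (1, 0) * det (mat_delete A 1 0)"
proof -
  have "det A = (\<Sum>r<m. A $$ (r, 0) * cofactor A r 0)"
    using assms by (intro laplace_expansion_column[OF A]) auto
  also have "\<dots> = (\<Sum>r\<in>{0, 1}. A $$ (r, 0) * cofactor A r 0)"
    by (rule sum.mono_neutral_right) (use \<open>m \<ge> 2\<close> 0 in auto)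
  also have "\<dots> = A $$ (0, 0) * det (mat_delete A 0 0) - A $$ (1, 0) * det (mat_delete A 1 0)"
    by (simp add: cofactor_def)
  finally show ?thesis .
qed

lemma det_first_row_sparse:
  assumes A: "A \<in> carrier_mat m m" and "m \<ge> 1"
    and 0: "\<And>s. 1 \<le> s \<Longrightarrow> s < m \<Longrightarrow> A $$ (0, s) = 0"
  shows "det A = A $$ (0, 0) * det (mat_delete A 0 0)"
proof -
  have "det A = (\<Sum>s<m. A $$ (0, s) * cofactor A 0 s)"
    using assms by (intro laplace_expansion_row[OF A]) auto
  also have "\<dots> = (\<Sum>s\<in>{0}. A $$ (0, s) * cofactor A 0 s)"
    by (rule sum.mono_neutral_right) (use \<open>m \<ge> 1\<close> 0 in auto)
  also have "\<dots> = A $$ (0, 0) * det (mat_delete A 0 0)"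
    by (simp add: cofactor_def)
  finally show ?thesis .
qed

lemma det_jacobi_pencil: "det (jacobi_pencil c b i m) = jacobi_poly c b i m"
proof (induction c b i m rule: jacobi_poly.induct)
  case (1 c b i)
  show ?case by (simp add: jacobi_pencil_def)
next
  case (2 c b i)
  show ?case by (subst det_single) (auto simp: jacobi_pencil_def)
next
  case (3 c b i m)
  let ?A = "jacobi_pencil c b i (Suc (Suc m))"
  let ?B = "mat_delete ?A 1 0"
  have A: "?A \<in> carrier_mat (Suc (Suc m)) (Suc (Suc m))"
    by (simp add: jacobi_pencil_def)
  have B: "?B \<in> carrier_mat (Suc m) (Suc m)"
    using mat_delete_carrier[OF A] by simp
  have del00: "mat_delete ?A 0 0 = jacobi_pencil c b (Suc i) (Suc m)"
    by (rule eq_matI) (auto simp: mat_delete_def jacobi_pencil_def)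
  have delB: "mat_delete ?B 0 0 = jacobi_pencil c b (Suc (Suc i)) m"
    by (rule eq_matI) (auto simp: mat_delete_def jacobi_pencil_def)
  have "det ?B = ?B $$ (0, 0) * det (mat_delete ?B 0 0)"
    by (rule det_first_row_sparse[OF B]) (auto simp: mat_delete_def jacobi_pencil_def)
  also have "?B $$ (0, 0) = [:- b i:]"
    by (simp add: mat_delete_def jacobi_pencil_def)
  finally have detB: "det ?B = [:- b i:] * jacobi_poly c b (Suc (Suc i)) m"
    unfolding delB 3 .
  have "det ?A = ?A $$ (0, 0) * det (mat_delete ?A 0 0) - ?A $$ (1, 0) * det ?B"
    by (rule det_first_column_sparse[OF A]) (auto simp: jacobi_pencil_def)
  also have "?A $$ (0, 0) = [:- c i, 1:]"
    by (simp add: jacobi_pencil_def)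
  also have "?A $$ (1, 0) = [:- b i:]"
    by (simp add: jacobi_pencil_def)
  finally show ?case
    unfolding del00 detB 3 by (simp add: power2_eq_square)
qed

text \<open>
  The matrix \<open>x - J\<close>. The two corner entries \<open>p\<close>, \<open>q\<close> are independent, since the
  determinant formula is an identity over commutative rings; complex conjugation enters later.
\<close>
definition corner_pencil ::
    "nat \<Rightarrow> (nat \<Rightarrow> 'a::comm_ring_1) \<Rightarrow> (nat \<Rightarrow> 'a) \<Rightarrow> 'a \<Rightarrow> 'a \<Rightarrow> 'a \<Rightarrow> 'a poly mat" where
  "corner_pencil N c b a p q = mat (N + 1) (N + 1) (\<lambda>(r, s).
     if r = s then (if r = N then [:- a, 1:] else [:- c (r + 1), 1:])
     else if s = r + 1 then [:- b (r + 1):]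
     else if r = s + 1 then [:- b (s + 1):]
     else if r = 0 \<and> s = N then [:- q:]
     else if r = N \<and> s = 0 then [:- p:]
     else 0)"

lemma prod_const_poly: "(\<Prod>x\<in>A. [:f x:]) = [:\<Prod>x\<in>A. f x:]"
  by (induction A rule: infinite_finite_induct) (auto simp: one_pCons mult.commute)

lemma det_last_column_sparse:
  assumes A: "A \<in> carrier_mat N N" and "N \<ge> 2"
    and 0: "\<And>r. 1 \<le> r \<Longrightarrow> r < N - 1 \<Longrightarrow> A $$ (r, N - 1) = 0"
  shows "det A = (- 1) ^ (N - 1) * A $$ (0, N - 1) * det (mat_delete A 0 (N - 1))
      + A $$ (N - 1, N - 1) * det (mat_delete A (N - 1) (N - 1))"
proof -
  have "det A = (\<Sum>r<N. A $$ (r, N - 1) * cofactor A r (N - 1))"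
    using assms by (intro laplace_expansion_column[OF A]) auto
  also have "\<dots> = (\<Sum>r\<in>{0, N - 1}. A $$ (r, N - 1) * cofactor A r (N - 1))"
  proof (rule sum.mono_neutral_right)
    show "\<forall>r\<in>{..<N} - {0, N - 1}. A $$ (r, N - 1) * cofactor A r (N - 1) = 0"
    proof
      fix r assume "r \<in> {..<N} - {0, N - 1}"
      then have "1 \<le> r" "r < N - 1" by auto
      then show "A $$ (r, N - 1) * cofactor A r (N - 1) = 0" using 0 by simp
    qed
  qed (use \<open>N \<ge> 2\<close> in auto)
  also have "\<dots> = (- 1) ^ (N - 1) * A $$ (0, N - 1) * det (mat_delete A 0 (N - 1))
      + A $$ (N - 1, N - 1) * det (mat_delete A (N - 1) (N - 1))"
    using \<open>N \<ge> 2\<close> by (simp add: cofactor_def mult_ac flip: mult_2)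
  finally show ?thesis .
qed

lemma prod_uminus_nat: "(\<Prod>r<m. - f (Suc r)) = (- 1) ^ m * (\<Prod>k=1..m. f k :: 'a::comm_ring_1)"
  by (induction m) (simp_all add: mult_ac)

text \<open>
  Expansion along the last row. The minor belonging to the diagonal entry is a Jacobi pencil; each of
  the other two minors has at most two nonzero entries in its last column, and expanding there
  leaves either a Jacobi pencil or a triangular matrix with diagonal \<open>-b\<^sub>1, \<dots>, -b\<^sub>N\<^sub>-\<^sub>1\<close>.
  The two triangular ones are the two cyclic permutations, which give the term with the full product
  of the \<open>b\<^sub>k\<close>.
\<close>
lemma det_corner_pencil:
  fixes c b :: "nat \<Rightarrow> 'a::comm_ring_1"
  assumes N: "N \<ge> 2"
  shows "det (corner_pencil N c b a p q) =
    [:- a, 1:] * jacobi_poly c b 1 N - Polynomial.smult (p * q) (jacobi_poly c b 2 (N - 1))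
      - Polynomial.smult ((b N)\<^sup>2) (jacobi_poly c b 1 (N - 1)) - [:(p + q) * (\<Prod>k=1..N. b k):]"
proof -
  define A where "A = corner_pencil N c b a p q"
  define D where "D j = mat_delete A N j" for j
  have A: "A \<in> carrier_mat (Suc N) (Suc N)"
    by (simp add: A_def corner_pencil_def)
  have D: "D j \<in> carrier_mat N N" for j
    using mat_delete_carrier[OF A] by (simp add: D_def)
  define \<pi> where "\<pi> = (\<Prod>k=1..N-1. b k)"
  have \<pi>: "(\<Prod>r<N-1. - b (Suc r)) = (- 1) ^ (N - 1) * \<pi>"
    unfolding \<pi>_def by (rule prod_uminus_nat)
  have \<pi>N: "(\<Prod>k=1..N. b k) = \<pi> * b N"
    using N by (cases N) (auto simp: \<pi>_def)
  have diag: "prod_list (diag_mat M) = [:(- 1) ^ (N - 1) * \<pi>:]"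
    if "M \<in> carrier_mat (N - 1) (N - 1)" "\<And>r. r < N - 1 \<Longrightarrow> M $$ (r, r) = [:- b (Suc r):]" for M
  proof -
    have "prod_list (diag_mat M) = (\<Prod>r<N-1. [:- b (Suc r):])"
      using that by (auto simp: prod_list_diag_prod atLeast0LessThan intro!: prod.cong)
    also have "\<dots> = [:(- 1) ^ (N - 1) * \<pi>:]"
      unfolding prod_const_poly \<pi> ..
    finally show ?thesis .
  qed
  have D_top: "mat_delete (D 0) 0 (N - 1) = jacobi_pencil c b 2 (N - 1)"
    by (rule eq_matI) (use N in \<open>auto simp: D_def A_def mat_delete_def jacobi_pencil_def corner_pencil_def\<close>)
  have D_bot: "det (mat_delete (D 0) (N - 1) (N - 1)) = [:(- 1) ^ (N - 1) * \<pi>:]"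
  proof -
    have c: "mat_delete (D 0) (N - 1) (N - 1) \<in> carrier_mat (N - 1) (N - 1)"
      by (rule mat_delete_carrier[OF D])
    have "det (mat_delete (D 0) (N - 1) (N - 1)) = prod_list (diag_mat (mat_delete (D 0) (N - 1) (N - 1)))"
      by (rule det_lower_triangular[OF _ c])
         (use N in \<open>auto simp: D_def A_def mat_delete_def corner_pencil_def\<close>)
    also have "\<dots> = [:(- 1) ^ (N - 1) * \<pi>:]"
      by (rule diag[OF c]) (use N in \<open>auto simp: D_def A_def mat_delete_def corner_pencil_def\<close>)
    finally show ?thesis .
  qed
  have D0: "det (D 0) = (- 1) ^ N * Polynomial.smult q (jacobi_poly c b 2 (N - 1))
      + [:(- 1) ^ N * (\<pi> * b N):]"
  proof -
    have "D 0 $$ (0, N - 1) = [:- q:]" "D 0 $$ (N - 1, N - 1) = [:- b N:]"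
      using N by (auto simp: D_def A_def mat_delete_def corner_pencil_def)
    moreover have "det (D 0) = (- 1) ^ (N - 1) * D 0 $$ (0, N - 1) * det (mat_delete (D 0) 0 (N - 1))
        + D 0 $$ (N - 1, N - 1) * det (mat_delete (D 0) (N - 1) (N - 1))"
      by (rule det_last_column_sparse[OF D N])
         (use N in \<open>auto simp: D_def A_def mat_delete_def corner_pencil_def\<close>)
    moreover have "(- 1 :: 'a poly) ^ N = - ((- 1) ^ (N - 1))" "(- 1 :: 'a) ^ N = - ((- 1) ^ (N - 1))"
      using N by (cases N; simp)+
    ultimately show ?thesis
      unfolding D_top D_bot det_jacobi_pencil by (simp add: mult_ac)
  qed
  have D0': "(- 1) ^ N * det (D 0) = Polynomial.smult q (jacobi_poly c b 2 (N - 1)) + [:\<pi> * b N:]"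
    unfolding D0 by (cases "even N") simp_all
  have D_top': "det (mat_delete (D (N - 1)) 0 (N - 1)) = [:(- 1) ^ (N - 1) * \<pi>:]"
  proof -
    have c: "mat_delete (D (N - 1)) 0 (N - 1) \<in> carrier_mat (N - 1) (N - 1)"
      by (rule mat_delete_carrier[OF D])
    have "det (mat_delete (D (N - 1)) 0 (N - 1)) = prod_list (diag_mat (mat_delete (D (N - 1)) 0 (N - 1)))"
      by (rule det_upper_triangular[OF _ c])
         (use N in \<open>auto intro!: upper_triangularI simp: D_def A_def mat_delete_def corner_pencil_def\<close>)
    also have "\<dots> = [:(- 1) ^ (N - 1) * \<pi>:]"
      by (rule diag[OF c]) (use N in \<open>auto simp: D_def A_def mat_delete_def corner_pencil_def\<close>)
    finally show ?thesis .
  qed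
  have D_bot': "mat_delete (D (N - 1)) (N - 1) (N - 1) = jacobi_pencil c b 1 (N - 1)"
    by (rule eq_matI) (use N in \<open>auto simp: D_def A_def mat_delete_def jacobi_pencil_def corner_pencil_def\<close>)
  have D1: "det (D (N - 1)) = - [:q * \<pi>:] - Polynomial.smult (b N) (jacobi_poly c b 1 (N - 1))"
  proof -
    have "D (N - 1) $$ (0, N - 1) = [:- q:]" "D (N - 1) $$ (N - 1, N - 1) = [:- b N:]"
      using N by (auto simp: D_def A_def mat_delete_def corner_pencil_def)
    moreover have "det (D (N - 1)) =
        (- 1) ^ (N - 1) * D (N - 1) $$ (0, N - 1) * det (mat_delete (D (N - 1)) 0 (N - 1))
        + D (N - 1) $$ (N - 1, N - 1) * det (mat_delete (D (N - 1)) (N - 1) (N - 1))"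
      by (rule det_last_column_sparse[OF D N])
         (use N in \<open>auto simp: D_def A_def mat_delete_def corner_pencil_def\<close>)
    moreover have "(- 1 :: 'a poly) ^ m = [:(- 1) ^ m:]" for m
      by (induction m) (simp_all add: one_pCons)
    ultimately show ?thesis
      unfolding D_top' D_bot' det_jacobi_pencil by (simp add: mult_ac flip: power_add mult_2)
  qed
  have D2: "D N = jacobi_pencil c b 1 N"
    by (rule eq_matI) (auto simp: D_def A_def mat_delete_def jacobi_pencil_def corner_pencil_def)
  define L where "L = [:- a, 1:] * jacobi_poly c b 1 N"
  define K1 where "K1 = jacobi_poly c b 1 (N - 1)"
  define K2 where "K2 = jacobi_poly c b 2 (N - 1)"
  have "det A = (\<Sum>j<Suc N. A $$ (N, j) * cofactor A N j)"
    by (rule laplace_expansion_row[OF A]) auto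
  also have "\<dots> = (\<Sum>j\<in>{0, N - 1, N}. A $$ (N, j) * cofactor A N j)"
    by (rule sum.mono_neutral_right) (use N in \<open>auto simp: A_def corner_pencil_def\<close>)
  also have "\<dots> = A $$ (N, 0) * ((- 1) ^ N * det (D 0))
       + A $$ (N, N - 1) * ((- 1) ^ (N + (N - 1)) * det (D (N - 1))) + A $$ (N, N) * det (D N)"
    using N by (simp add: cofactor_def D_def flip: mult_2)
  also have "(- 1 :: 'a poly) ^ (N + (N - 1)) = - 1"
    using N by (cases N) auto
  also have "A $$ (N, 0) = [:- p:]" using N by (simp add: A_def corner_pencil_def)
  also have "A $$ (N, N - 1) = [:- b N:]" using N by (auto simp: A_def corner_pencil_def)
  also have "A $$ (N, N) = [:- a, 1:]" by (simp add: A_def corner_pencil_def)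
  finally have "det A = [:- p:] * (Polynomial.smult q K2 + [:\<pi> * b N:])
      + [:- b N:] * (- 1 * (- [:q * \<pi>:] - Polynomial.smult (b N) K1)) + L"
    unfolding D0' D1 D2 det_jacobi_pencil L_def K1_def K2_def .
  also have "\<dots> = L - Polynomial.smult (p * q) K2 - Polynomial.smult ((b N)\<^sup>2) K1
      - [:(p + q) * (\<pi> * b N):]"
    by (simp add: algebra_simps power2_eq_square smult_add_right smult_diff_right)
  finally show ?thesis
    unfolding \<pi>N A_def L_def K1_def K2_def .
qed

section \<open>Algebra and interlacing of Jacobi polynomials\<close>

text \<open>
  Only the squares of the off-diagonal entries matter; this is why the spectra determine the
  \<open>b\<^sub>k\<close> at best up to sign.
\<close>
lemma jacobi_poly_cong:
  assumes "\<And>k. i \<le> k \<Longrightarrow> k < i + m \<Longrightarrow> c k = c' k"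
    and "\<And>k. i \<le> k \<Longrightarrow> k + 1 < i + m \<Longrightarrow> (b k)\<^sup>2 = (b' k)\<^sup>2"
  shows "jacobi_poly c b i m = jacobi_poly c' b' i m"
  using assms
proof (induction c b i m rule: jacobi_poly.induct)
  case (3 c b i m)
  have "jacobi_poly c b (Suc i) (Suc m) = jacobi_poly c' b' (Suc i) (Suc m)"
    by (rule "3.IH"(1)) (use "3.prems" in auto)
  moreover have "jacobi_poly c b (Suc (Suc i)) m = jacobi_poly c' b' (Suc (Suc i)) m"
    by (rule "3.IH"(2)) (use "3.prems" in auto)
  moreover have "c i = c' i" "(b i)\<^sup>2 = (b' i)\<^sup>2"
    using "3.prems" by auto
  ultimately show ?case by simp
qed auto

lemma jacobi_poly_monic:
  "degree (jacobi_poly c b i m) = m" "coeff (jacobi_poly c b i m) m = 1"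
proof -
  have "degree (jacobi_poly c b i m) \<le> m \<and> coeff (jacobi_poly c b i m) m = 1"
  proof (induction c b i m rule: jacobi_poly.induct)
    case (3 c b i m)
    let ?Q = "jacobi_poly c b (Suc i) (Suc m)" and ?R = "jacobi_poly c b (Suc (Suc i)) m"
    have "degree ([:- c i, 1:] * ?Q) \<le> Suc (Suc m)"
      using degree_mult_le[of "[:- c i, 1:]" ?Q] 3 by auto
    moreover have "degree (Polynomial.smult ((b i)\<^sup>2) ?R) \<le> Suc (Suc m)"
      using degree_smult_le[of "(b i)\<^sup>2" ?R] 3 by linarith
    moreover have "coeff ?Q (Suc (Suc m)) = 0" "coeff ?R (Suc (Suc m)) = 0"
      using 3 by (auto intro!: coeff_eq_0)
    ultimately show ?case using 3 by (auto intro!: degree_diff_le)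
  qed auto
  then show "coeff (jacobi_poly c b i m) m = 1" "degree (jacobi_poly c b i m) = m"
    by (auto intro!: antisym le_degree)
qed

lemma map_poly_of_real_jacobi_poly:
  "map_poly complex_of_real (jacobi_poly c b i m) =
     jacobi_poly (\<lambda>k. complex_of_real (c k)) (\<lambda>k. complex_of_real (b k)) i m"
proof (induction c b i m rule: jacobi_poly.induct)
  case (3 c b i m)
  interpret h: map_poly_comm_ring_hom complex_of_real ..
  show ?case using 3
    by (simp add: h.hom_minus h.hom_mult of_real_hom.map_poly_hom_smult del: mult_pCons_left)
qed auto

text \<open>
  At a zero of the characteristic polynomial of the whole matrix, the polynomials of the matrices
  without first and without last row multiply to \<open>\<Prod> b\<^sub>k\<^sup>2\<close>. The left hand side is a
  Casorati determinant of two solutions of the three-term recurrence, and one step of the recurrence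
  only multiplies it by \<open>b\<^sub>i\<^sup>2\<close>.
\<close>
lemma jacobi_poly_casorati:
  fixes c b :: "nat \<Rightarrow> 'a::comm_ring_1"
  shows "jacobi_poly c b i (m + 2) * jacobi_poly c b (i + 1) m
    - jacobi_poly c b (i + 1) (m + 1) * jacobi_poly c b i (m + 1)
    = - [:\<Prod>k=i..i+m. (b k)\<^sup>2:]"
proof (induction m arbitrary: i)
  case 0
  show ?case by (simp add: algebra_simps)
next
  case (Suc m)
  let ?K = "jacobi_poly c b"
  have "?K i (Suc m + 2) * ?K (i + 1) (Suc m) - ?K (i + 1) (Suc m + 1) * ?K i (Suc m + 1)
    = Polynomial.smult ((b i)\<^sup>2)
        (?K (i + 1 + 1) (m + 1) * ?K (i + 1) (m + 1) * - 1 + ?K (i + 1) (m + 2) * ?K (i + 1 + 1) m)"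
    by (simp add: algebra_simps smult_diff_right smult_add_right)
  also have "\<dots> = Polynomial.smult ((b i)\<^sup>2) (- [:\<Prod>k=i+1..i+1+m. (b k)\<^sup>2:])"
    by (subst Suc.IH[of "i + 1", symmetric]) (simp add: algebra_simps)
  also have "\<dots> = - [:\<Prod>k=i..i+Suc m. (b k)\<^sup>2:]"
    by (simp add: prod.atLeast_Suc_atMost[of i])
  finally show ?case .
qed

text \<open>
  If \<open>P = (x - c) Q - b\<^sup>2 R\<close>, then the Wronskians satisfy \<open>W(P, Q) = Q\<^sup>2 + b\<^sup>2 W(Q, R)\<close>,
  so positivity propagates along the recurrence.
\<close>
lemma jacobi_poly_wronskian_pos:
  fixes c b :: "nat \<Rightarrow> real"
  assumes "\<And>k. i \<le> k \<Longrightarrow> k < i + m \<Longrightarrow> b k \<noteq> 0"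
  shows "0 < poly (pderiv (jacobi_poly c b i (m + 1))) x * poly (jacobi_poly c b (i + 1) m) x
    - poly (jacobi_poly c b i (m + 1)) x * poly (pderiv (jacobi_poly c b (i + 1) m)) x"
  using assms
proof (induction m arbitrary: i)
  case 0
  show ?case by (simp add: pderiv_pCons)
next
  case (Suc m)
  let ?K = "jacobi_poly c b"
  let ?Q = "?K (i + 1) (m + 1)" and ?R = "?K (i + 1 + 1) m"
  have P: "?K i (Suc m + 1) = [:- c i, 1:] * ?Q - Polynomial.smult ((b i)\<^sup>2) ?R"
    by simp
  have "0 < poly (pderiv ?Q) x * poly ?R x - poly ?Q x * poly (pderiv ?R) x"
    by (rule Suc.IH) (use Suc.prems in auto)
  then have "0 < (poly ?Q x)\<^sup>2 + (b i)\<^sup>2 *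
      (poly (pderiv ?Q) x * poly ?R x - poly ?Q x * poly (pderiv ?R) x)"
    using Suc.prems[of i] by (intro add_nonneg_pos mult_pos_pos) auto
  then show ?case
    unfolding P
    by (simp add: pderiv_diff pderiv_mult pderiv_smult pderiv_pCons algebra_simps power2_eq_square
        del: jacobi_poly.simps mult_pCons_left)
qed

lemma linear_prod_monic:
  fixes f :: "'b \<Rightarrow> 'a::idom"
  assumes "finite A"
  shows "degree (\<Prod>j\<in>A. [:- f j, 1:]) = card A" "coeff (\<Prod>j\<in>A. [:- f j, 1:]) (card A) = 1"
proof -
  show d: "degree (\<Prod>j\<in>A. [:- f j, 1:]) = card A"
    by (subst degree_prod_sum_eq) auto
  show "coeff (\<Prod>j\<in>A. [:- f j, 1:]) (card A) = 1"
    using lead_coeff_prod[of "\<lambda>j. [:- f j, 1:]" A] by (simp add: d)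
qed

lemma sgn_prod_diff:
  fixes f :: "'b \<Rightarrow> real"
  assumes "finite A" "\<And>j. j \<in> A \<Longrightarrow> f j \<noteq> x"
  shows "0 < (- 1) ^ card {j\<in>A. x < f j} * (\<Prod>j\<in>A. x - f j)"
  using assms
proof (induction A)
  case empty
  show ?case by simp
next
  case (insert a A)
  have IH: "0 < (- 1) ^ card {j\<in>A. x < f j} * (\<Prod>j\<in>A. x - f j)"
    using insert by auto
  show ?case
  proof (cases "x < f a")
    case True
    have "{j \<in> insert a A. x < f j} = insert a {j\<in>A. x < f j}" using True by auto
    then have "(- 1) ^ card {j \<in> insert a A. x < f j} * (\<Prod>j\<in>insert a A. x - f j)
      = (f a - x) * ((- 1) ^ card {j\<in>A. x < f j} * (\<Prod>j\<in>A. x - f j))"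
      using insert by (simp add: algebra_simps)
    then show ?thesis using IH True by simp
  next
    case False
    have "{j \<in> insert a A. x < f j} = {j\<in>A. x < f j}" using False by auto
    then have "(- 1) ^ card {j \<in> insert a A. x < f j} * (\<Prod>j\<in>insert a A. x - f j)
      = (x - f a) * ((- 1) ^ card {j\<in>A. x < f j} * (\<Prod>j\<in>A. x - f j))"
      using insert by (simp add: algebra_simps)
    then show ?thesis using IH False insert.prems[of a] by simp
  qed
qed

lemma sgn_node_prod:
  fixes mu :: "nat \<Rightarrow> real"
  assumes mu: "strict_mono_on {1..N} mu" and k: "k \<in> {1..N}"
  shows "0 < (- 1) ^ (N - k) * (\<Prod>j\<in>{1..N} - {k}. mu k - mu j)"
proof -
  have "{j \<in> {1..N} - {k}. mu k < mu j} = {k<..N}"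
    using k strict_mono_on_less[OF mu] by auto
  moreover have "mu j \<noteq> mu k" if "j \<in> {1..N} - {k}" for j
    using that k strict_mono_on_eqD[OF mu, of j k] by auto
  ultimately show ?thesis
    using sgn_prod_diff[of "{1..N} - {k}" mu "mu k"] by simp
qed

lemma poly_pderiv_linear_prod_at_root:
  fixes mu :: "'b \<Rightarrow> 'a::idom"
  assumes "finite A" "k \<in> A"
  shows "poly (pderiv (\<Prod>j\<in>A. [:- mu j, 1:])) (mu k) = (\<Prod>j\<in>A - {k}. mu k - mu j)"
proof -
  have "(\<Prod>j\<in>A. [:- mu j, 1:]) = [:- mu k, 1:] * (\<Prod>j\<in>A - {k}. [:- mu j, 1:])"
    using assms by (simp add: prod.remove)
  then show ?thesis
    by (simp add: pderiv_mult pderiv_pCons poly_prod del: mult_pCons_left)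
qed

text \<open>
  At a zero \<open>mu k\<close> of \<open>P\<close> the positive Wronskian is \<open>P' Q\<close>, so \<open>Q\<close> has there the sign of
  \<open>P'\<close>, which alternates.
\<close>
lemma jacobi_poly_interlacing:
  fixes c b mu :: "nat \<Rightarrow> real"
  assumes mu: "strict_mono_on {1..N} mu" and k: "k \<in> {1..N}"
    and b: "\<And>l. i \<le> l \<Longrightarrow> l + 1 < i + N \<Longrightarrow> b l \<noteq> 0"
    and P: "jacobi_poly c b i N = (\<Prod>j=1..N. [:- mu j, 1:])"
  shows "0 < (- 1) ^ (N - k) * poly (jacobi_poly c b (i + 1) (N - 1)) (mu k)"
proof -
  let ?d = "\<Prod>j\<in>{1..N} - {k}. mu k - mu j" and ?q = "poly (jacobi_poly c b (i + 1) (N - 1)) (mu k)"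
  have N: "N - 1 + 1 = N" using k by auto
  have "poly (jacobi_poly c b i N) (mu k) = 0"
    using k by (auto simp: P poly_prod intro!: prod_zero)
  moreover have "poly (pderiv (jacobi_poly c b i N)) (mu k) = ?d"
    unfolding P by (rule poly_pderiv_linear_prod_at_root) (use k in auto)
  ultimately have "0 < ?d * ?q"
    using jacobi_poly_wronskian_pos[of i "N - 1" b c "mu k"] b k unfolding N by auto
  moreover have "0 < (- 1) ^ (N - k) * ?d" by (rule sgn_node_prod[OF mu k])
  ultimately show ?thesis
    by (cases "even (N - k)") (auto simp: zero_less_mult_iff mult_less_0_iff)
qed

section \<open>Interpolation and division of polynomials\<close>

lemma lagrange_interpolation:
  fixes x y :: "'b \<Rightarrow> 'a::field"
  assumes "finite A" "inj_on x A"
  shows "\<exists>S. degree S \<le> card A - 1 \<and> (\<forall>k\<in>A. poly S (x k) = y k) \<and>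
    coeff S (card A - 1) = (\<Sum>k\<in>A. y k / (\<Prod>j\<in>A - {k}. x k - x j))"
proof -
  define w where "w k = y k / (\<Prod>j\<in>A - {k}. x k - x j)" for k
  define S where "S = (\<Sum>k\<in>A. Polynomial.smult (w k) (\<Prod>j\<in>A - {k}. [:- x j, 1:]))"
  have mon: "degree (\<Prod>j\<in>A - {k}. [:- x j, 1:]) = card A - 1"
      "coeff (\<Prod>j\<in>A - {k}. [:- x j, 1:]) (card A - 1) = 1" if "k \<in> A" for k
    using linear_prod_monic[of "A - {k}" x] that assms by (auto simp: card_Diff_singleton)
  have "degree S \<le> card A - 1"
    unfolding S_def using assms(1)
    by (intro degree_sum_le) (auto intro: order.trans[OF degree_smult_le] simp: mon)
  moreover have "coeff S (card A - 1) = (\<Sum>k\<in>A. w k)"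
    unfolding S_def by (auto simp: coeff_sum mon[simplified] intro!: sum.cong)
  moreover have "poly S (x k) = y k" if k: "k \<in> A" for k
  proof -
    have nz: "(\<Prod>j\<in>A - {k}. x k - x j) \<noteq> 0"
      using assms k by (auto simp: inj_on_def)
    have "poly S (x k) = (\<Sum>l\<in>A. w l * (\<Prod>j\<in>A - {l}. x k - x j))"
      unfolding S_def by (simp add: poly_sum poly_prod)
    also have "\<dots> = (\<Sum>l\<in>{k}. w l * (\<Prod>j\<in>A - {l}. x k - x j))"
      by (rule sum.mono_neutral_right) (use k assms in \<open>auto intro!: prod_zero\<close>)
    also have "\<dots> = y k"
      using nz by (simp add: w_def)
    finally show ?thesis .
  qed
  ultimately show ?thesis unfolding w_def by blast
qed

text \<open>
  Used to see that a polynomial whose values alternate in sign like the node products has a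
  positive top coefficient, so that its degree does not drop.
\<close>
lemma lagrange_top_coeff:
  fixes x :: "'b \<Rightarrow> 'a::field"
  assumes A: "finite A" "inj_on x A" "A \<noteq> {}" and S: "degree S \<le> card A - 1"
  shows "coeff S (card A - 1) = (\<Sum>k\<in>A. poly S (x k) / (\<Prod>j\<in>A - {k}. x k - x j))"
proof -
  obtain T where T: "degree T \<le> card A - 1" "\<forall>k\<in>A. poly T (x k) = poly S (x k)"
    "coeff T (card A - 1) = (\<Sum>k\<in>A. poly S (x k) / (\<Prod>j\<in>A - {k}. x k - x j))"
    using lagrange_interpolation[OF A(1,2), of "\<lambda>k. poly S (x k)"] by blast
  have "card A > 0" using A by (simp add: card_gt_0_iff)
  then have "S = T"
    using T S A by (intro poly_eqI_degree[of "x ` A"]) (auto simp: card_image)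
  then show ?thesis using T by simp
qed

lemma monic_linear_division:
  fixes P Q :: "'a::idom poly"
  assumes "degree P = Suc m" "coeff P (Suc m) = 1" "degree Q = m" "coeff Q m = 1" "m \<ge> 1"
  shows "\<exists>d. degree (P - [:- d, 1:] * Q) < m"
proof -
  define d where "d = coeff Q (m - 1) - coeff P m"
  have "coeff (P - [:- d, 1:] * Q) k = 0" if k: "k \<ge> m" for k
  proof -
    consider "k = m" | "k = Suc m" | "k > Suc m" using k by linarith
    then show ?thesis
    proof cases
      case 1
      then show ?thesis using assms by (cases m) (auto simp: d_def)
    next
      case 2
      then show ?thesis using assms by (auto simp: coeff_eq_0)
    next
      case 3
      then show ?thesis using assms by (cases k) (auto simp: coeff_eq_0)
    qed
  qed
  then show ?thesis using \<open>m \<ge> 1\<close> by (intro exI[of _ d] degree_lessI) auto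
qed

section \<open>The inverse problem for Jacobi matrices\<close>

text \<open>
  The sign changes of \<open>Q\<close> put a zero strictly between any two neighbouring nodes, and these already
  account for the degree.
\<close>
lemma interlacing_roots:
  fixes mu :: "nat \<Rightarrow> real"
  assumes mu: "strict_mono_on {1..Suc m} mu"
    and Q: "degree Q = m" "coeff Q m = 1"
    and sgn: "\<And>k. k \<in> {1..Suc m} \<Longrightarrow> 0 < (- 1) ^ (Suc m - k) * poly Q (mu k)"
  obtains \<nu> where "strict_mono_on {1..m} \<nu>" "Q = (\<Prod>j=1..m. [:- \<nu> j, 1:])"
    "\<And>k. k \<in> {1..m} \<Longrightarrow> mu k < \<nu> k \<and> \<nu> k < mu (Suc k)"
proof -
  have "\<exists>x. mu k < x \<and> x < mu (Suc k) \<and> poly Q x = 0" if k: "k \<in> {1..m}" for k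
  proof -
    have "mu k < mu (Suc k)"
      using k by (intro strict_mono_onD[OF mu]) auto
    moreover have "(- 1 :: real) ^ (Suc m - k) = - ((- 1) ^ (m - k))"
      using k by (simp add: Suc_diff_le)
    then have "poly Q (mu k) * poly Q (mu (Suc k)) < 0"
      using sgn[of k] sgn[of "Suc k"] k
      by (cases "even (m - k)") (auto simp: mult_less_0_iff)
    ultimately show ?thesis using poly_IVT by blast
  qed
  then obtain \<nu> where \<nu>: "\<And>k. k \<in> {1..m} \<Longrightarrow> mu k < \<nu> k \<and> \<nu> k < mu (Suc k) \<and> poly Q (\<nu> k) = 0"
    by metis
  have mono: "strict_mono_on {1..m} \<nu>"
  proof (rule strict_mono_onI)
    fix k l assume kl: "k \<in> {1..m}" "l \<in> {1..m}" "k < l"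
    have "mu (Suc k) \<le> mu l"
      using kl by (intro strict_mono_on_leD[OF mu]) auto
    then show "\<nu> k < \<nu> l" using \<nu>[of k] \<nu>[of l] kl by linarith
  qed
  have "Q = (\<Prod>j=1..m. [:- \<nu> j, 1:])"
  proof (rule poly_eqI_degree_lead_coeff[where n = m and A = "\<nu> ` {1..m}"])
    show "m \<le> card (\<nu> ` {1..m})"
      using strict_mono_on_imp_inj_on[OF mono] by (simp add: card_image)
    show "poly Q z = poly (\<Prod>j=1..m. [:- \<nu> j, 1:]) z" if "z \<in> \<nu> ` {1..m}" for z
    proof -
      from that obtain k where "k \<in> {1..m}" "z = \<nu> k" by blast
      then show ?thesis using \<nu>[of k] by (auto simp: poly_prod intro!: bexI[of _ k])
    qed
  qed (use Q linear_prod_monic[of "{1..m}" \<nu>] in auto)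
  with mono \<nu> show ?thesis using that by blast
qed

text \<open>
  One step of Euclid's algorithm, \<open>P = (x - d) Q - S\<close>, peels off the first row. The remainder
  inherits the hypotheses: \<open>S = -P\<close> at the zeros \<open>\<nu>\<close> of \<open>Q\<close>, and since these interlace
  the zeros of \<open>P\<close>, the values \<open>S (\<nu> k)\<close> alternate as required. By Lagrange's formula the top
  coefficient of \<open>S\<close> is then a sum of positive terms, so it is the square of the new off-diagonal
  entry and \<open>S\<close> has the right degree.
\<close>
lemma jacobi_inverse_exists:
  fixes mu :: "nat \<Rightarrow> real"
  assumes "strict_mono_on {1..Suc m} mu"
    and "degree Q = m" "coeff Q m = 1"
    and "\<And>k. k \<in> {1..Suc m} \<Longrightarrow> 0 < (- 1) ^ (Suc m - k) * poly Q (mu k)"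
  shows "\<exists>c b. (\<forall>k. 0 < b k) \<and> jacobi_poly c b i (Suc m) = (\<Prod>j=1..Suc m. [:- mu j, 1:]) \<and>
    jacobi_poly c b (Suc i) m = Q"
  using assms
proof (induction m arbitrary: mu Q i)
  case 0
  have "Q = 1"
    using 0 by (metis degree_eq_zeroE coeff_pCons_0 one_pCons)
  then show ?case
    by (intro exI[of _ "\<lambda>_. mu 1"] exI[of _ "\<lambda>_. 1"]) auto
next
  case (Suc m)
  note mu = Suc.prems(1)
  obtain \<nu> where \<nu>: "strict_mono_on {1..Suc m} \<nu>" and Q: "Q = (\<Prod>j=1..Suc m. [:- \<nu> j, 1:])"
    and between: "\<And>k. k \<in> {1..Suc m} \<Longrightarrow> mu k < \<nu> k \<and> \<nu> k < mu (Suc k)"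
    using interlacing_roots[OF Suc.prems] by blast
  define P where "P = (\<Prod>j=1..Suc (Suc m). [:- mu j, 1:])"
  have P: "degree P = Suc (Suc m)" "coeff P (Suc (Suc m)) = 1"
    using linear_prod_monic[of "{1..Suc (Suc m)}" mu] by (auto simp: P_def)
  obtain d where d: "degree (P - [:- d, 1:] * Q) < Suc m"
    using monic_linear_division[OF P Suc.prems(2,3)] by auto
  \<comment> \<open>the sign convention makes the remainder the square of an off-diagonal entry times a monic polynomial\<close>
  define S where "S = [:- d, 1:] * Q - P"
  have S: "degree S \<le> m"
    using d unfolding S_def by (subst degree_minus[symmetric]) simp
  have S_sgn: "0 < (- 1) ^ (Suc m - k) * poly S (\<nu> k)" if k: "k \<in> {1..Suc m}" for k
  proof -
    have *: "\<nu> k < mu j \<longleftrightarrow> k < j" if j: "j \<in> {1..Suc (Suc m)}" for j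
    proof
      assume "k < j"
      then have "mu (Suc k) \<le> mu j"
        using j k by (intro strict_mono_on_leD[OF mu]) auto
      then show "\<nu> k < mu j" using between[OF k] by linarith
    next
      assume less: "\<nu> k < mu j"
      show "k < j"
      proof (rule ccontr)
        assume "\<not> k < j"
        then have "mu j \<le> mu k"
          using j k by (intro strict_mono_on_leD[OF mu]) auto
        then show False using between[OF k] less by linarith
      qed
    qed
    then have "{j \<in> {1..Suc (Suc m)}. \<nu> k < mu j} = {k<..Suc (Suc m)}"
      using k by auto
    moreover have "mu j \<noteq> \<nu> k" if "j \<in> {1..Suc (Suc m)}" for j
    proof (cases "j \<le> k")
      case True
      then have "mu j \<le> mu k"
        using that k by (intro strict_mono_on_leD[OF mu]) auto
      then show ?thesis using between[OF k] by linarith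
    next
      case False
      then have "\<nu> k < mu j" using *[OF that] by simp
      then show ?thesis by simp
    qed
    moreover have "poly P (\<nu> k) = (\<Prod>j=1..Suc (Suc m). \<nu> k - mu j)"
      unfolding P_def poly_prod by (rule prod.cong) simp_all
    ultimately have "0 < (- 1) ^ (Suc (Suc m) - k) * poly P (\<nu> k)"
      using sgn_prod_diff[of "{1..Suc (Suc m)}" mu "\<nu> k"]
      by (simp del: prod.cl_ivl_Suc)
    moreover have "poly Q (\<nu> k) = 0"
      unfolding Q poly_prod by (rule prod_zero) (use k in auto)
    ultimately show ?thesis
      using k by (simp add: S_def Suc_diff_le)
  qed
  have "coeff S m = (\<Sum>k=1..Suc m. poly S (\<nu> k) / (\<Prod>j\<in>{1..Suc m} - {k}. \<nu> k - \<nu> j))"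
    using lagrange_top_coeff[of "{1..Suc m}" \<nu> S] S strict_mono_on_imp_inj_on[OF \<nu>] by simp
  also have "\<dots> > 0"
  proof (rule sum_pos)
    fix k assume k: "k \<in> {1..Suc m}"
    have "0 < ((- 1) ^ (Suc m - k) * poly S (\<nu> k)) /
        ((- 1) ^ (Suc m - k) * (\<Prod>j\<in>{1..Suc m} - {k}. \<nu> k - \<nu> j))"
      by (intro divide_pos_pos S_sgn sgn_node_prod \<nu> k)
    then show "0 < poly S (\<nu> k) / (\<Prod>j\<in>{1..Suc m} - {k}. \<nu> k - \<nu> j)"
      by simp
  qed auto
  finally have s: "coeff S m > 0" .
  define R where "R = Polynomial.smult (1 / coeff S m) S"
  have "degree R = m"
    using s S le_degree[of S m] by (simp add: R_def)
  moreover have "coeff R m = 1"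
    using s by (simp add: R_def)
  moreover have "0 < (- 1) ^ (Suc m - k) * poly R (\<nu> k)" if "k \<in> {1..Suc m}" for k
    using S_sgn[OF that] s by (simp add: R_def)
  ultimately obtain c b where cb: "\<And>k. 0 < b k"
      "jacobi_poly c b (Suc i) (Suc m) = Q" "jacobi_poly c b (Suc (Suc i)) m = R"
    using Suc.IH[OF \<nu>, of R "Suc i"] unfolding Q by blast
  define c' where "c' = c(i := d)"
  define b' where "b' = b(i := sqrt (coeff S m))"
  have "jacobi_poly c' b' (Suc i) (Suc m) = Q" "jacobi_poly c' b' (Suc (Suc i)) m = R"
    unfolding cb(2,3)[symmetric] by (rule jacobi_poly_cong; simp add: c'_def b'_def)+
  moreover from this have "jacobi_poly c' b' i (Suc (Suc m)) = P"
    using s by (simp add: c'_def b'_def R_def) (simp add: S_def)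
  moreover have "\<forall>k. 0 < b' k"
    using cb(1) s by (simp add: b'_def)
  ultimately show ?case unfolding P_def by blast
qed

text \<open>
  The quotient and the remainder of the division of \<open>P\<close> by \<open>Q\<close> determine \<open>c i\<close> and
  \<open>(b i)\<^sup>2\<close>; positivity fixes the sign of \<open>b i\<close>.
\<close>
lemma jacobi_inverse_unique:
  fixes c b c' b' :: "nat \<Rightarrow> real"
  assumes "jacobi_poly c b i (Suc m) = jacobi_poly c' b' i (Suc m)"
    and "jacobi_poly c b (Suc i) m = jacobi_poly c' b' (Suc i) m"
    and "\<And>k. i \<le> k \<Longrightarrow> k < i + m \<Longrightarrow> 0 < b k \<and> 0 < b' k"
  shows "(\<forall>k. i \<le> k \<and> k \<le> i + m \<longrightarrow> c k = c' k) \<and> (\<forall>k. i \<le> k \<and> k < i + m \<longrightarrow> b k = b' k)"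
  using assms
proof (induction m arbitrary: i)
  case 0
  then show ?case by (auto simp: le_antisym)
next
  case (Suc m)
  define Q where "Q = jacobi_poly c b (Suc i) (Suc m)"
  define R where "R = jacobi_poly c b (Suc (Suc i)) m"
  define R' where "R' = jacobi_poly c' b' (Suc (Suc i)) m"
  have Q: "jacobi_poly c' b' (Suc i) (Suc m) = Q"
    using Suc.prems(2) by (simp add: Q_def)
  have mon: "coeff Q (Suc m) = 1" "coeff R m = 1" "coeff R' m = 1"
      "degree R = m" "degree R' = m"
    unfolding Q_def R_def R'_def by (rule jacobi_poly_monic)+
  have eq: "[:- c i, 1:] * Q - Polynomial.smult ((b i)\<^sup>2) R
      = [:- c' i, 1:] * Q - Polynomial.smult ((b' i)\<^sup>2) R'"
    using Suc.prems(1) Q by (simp add: Q_def R_def R'_def)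
  have "coeff R (Suc m) = 0" "coeff R' (Suc m) = 0"
    using mon by (auto intro!: coeff_eq_0)
  then have c: "c i = c' i"
    using arg_cong[OF eq, of "\<lambda>p. coeff p (Suc m)"] mon by simp
  then have eq': "Polynomial.smult ((b i)\<^sup>2) R = Polynomial.smult ((b' i)\<^sup>2) R'"
    using eq by simp
  have pos: "0 < b i" "0 < b' i"
    using Suc.prems(3)[of i] by auto
  have "(b i)\<^sup>2 = (b' i)\<^sup>2"
    using arg_cong[OF eq', of "\<lambda>p. coeff p m"] mon by simp
  then have b: "b i = b' i"
    using pos by (simp add: power2_eq_iff)
  have "Polynomial.smult ((b' i)\<^sup>2) (R - R') = 0"
    using eq' b by (simp add: smult_diff_right)
  then have "R = R'" using pos by simp
  then have "(\<forall>k. Suc i \<le> k \<and> k \<le> Suc i + m \<longrightarrow> c k = c' k) \<and>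
      (\<forall>k. Suc i \<le> k \<and> k < Suc i + m \<longrightarrow> b k = b' k)"
    using Suc.prems by (intro Suc.IH) (auto simp: R_def R'_def)
  then show ?case using c b
    by (metis Suc_leI add_Suc add_Suc_right le_neq_implies_less)
qed

section \<open>Matrices with prescribed spectra\<close>

lemma linear_prod_second_coeff:
  fixes f :: "nat \<Rightarrow> 'a::idom"
  shows "coeff (\<Prod>j=1..Suc m. [:- f j, 1:]) m = - (\<Sum>j=1..Suc m. f j)"
proof (induction m)
  case (Suc m)
  let ?p = "\<Prod>j=1..Suc m. [:- f j, 1:]"
  have "(\<Prod>j=1..Suc (Suc m). [:- f j, 1:]) = [:- f (Suc (Suc m)), 1:] * ?p"
    by simp
  then have "coeff (\<Prod>j=1..Suc (Suc m). [:- f j, 1:]) (Suc m)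
      = - f (Suc (Suc m)) * coeff ?p (Suc m) + coeff ?p m"
    by (simp only: mult_pCons_left) simp
  moreover have "coeff ?p (Suc m) = 1"
    using linear_prod_monic[of "{1..Suc m}" f] by simp
  ultimately show ?case using Suc by simp
qed simp

text \<open>
  The two sides are monic of degree \<open>N + 1\<close>. They are equal as soon as the next coefficients agree,
  which is the condition on \<open>a\<close>, and the values at the \<open>N\<close> zeros of the first factor agree. So
  the corner entry is fixed by the traces, and the spectrum of the whole matrix only imposes \<open>N\<close>
  scalar equations.
\<close>
lemma monic_eq_by_nodes_iff:
  fixes a :: "'a::idom" and lam mu :: "nat \<Rightarrow> 'a"
  assumes inj: "inj_on mu {1..N}" and "N \<ge> 1" and G: "degree G < N"
  shows "[:- a, 1:] * (\<Prod>j=1..N. [:- mu j, 1:]) - G = (\<Prod>j=1..Suc N. [:- lam j, 1:]) \<longleftrightarrow>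
    a = (\<Sum>j=1..Suc N. lam j) - (\<Sum>j=1..N. mu j) \<and>
    (\<forall>k\<in>{1..N}. poly (\<Prod>j=1..Suc N. [:- lam j, 1:]) (mu k) = - poly G (mu k))"
proof -
  obtain M where M: "N = Suc M" using \<open>N \<ge> 1\<close> by (cases N) auto
  define P where "P = (\<Prod>j=1..N. [:- mu j, 1:])"
  define X where "X = (\<Prod>j=1..Suc N. [:- lam j, 1:])"
  have P: "degree P = N" "coeff P N = 1"
    using linear_prod_monic[of "{1..N}" mu] by (auto simp: P_def)
  have X: "degree X = Suc N" "coeff X (Suc N) = 1"
    using linear_prod_monic[of "{1..Suc N}" lam] by (auto simp: X_def)
  have P1: "coeff P M = - (\<Sum>j=1..N. mu j)"
    unfolding P_def M by (rule linear_prod_second_coeff)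
  have X1: "coeff X N = - (\<Sum>j=1..Suc N. lam j)"
    unfolding X_def by (rule linear_prod_second_coeff)
  have GN: "coeff G k = 0" if "k \<ge> N" for k
    using G that by (intro coeff_eq_0) auto
  have aPN: "coeff ([:- a, 1:] * P) N = coeff P M - a" for a
    using P by (simp add: M)
  have P0: "poly P (mu k) = 0" if "k \<in> {1..N}" for k
    using that by (auto simp: P_def poly_prod intro!: prod_zero)
  have "[:- a, 1:] * P - G = X" if a: "a = (\<Sum>j=1..Suc N. lam j) - (\<Sum>j=1..N. mu j)"
    and nodes: "\<forall>k\<in>{1..N}. poly X (mu k) = - poly G (mu k)"
  proof -
    define D where "D = [:- a, 1:] * P - G - X"
    have "coeff D k = 0" if k: "k \<ge> N" for k
    proof -
      consider "k = N" | "k = Suc N" | "k > Suc N" using k by linarith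
      then show ?thesis
      proof cases
        case 1
        then show ?thesis
          unfolding D_def by (simp only: coeff_diff aPN P1 X1 GN a) simp
      next
        case 2
        then show ?thesis using P X GN by (simp add: D_def coeff_eq_0)
      next
        case 3
        then show ?thesis using P X GN by (cases k) (auto simp: D_def coeff_eq_0)
      qed
    qed
    then have "degree D < N"
      using \<open>N \<ge> 1\<close> by (intro degree_lessI) auto
    then have "D = 0"
      using nodes P0 card_image[OF inj]
      by (intro poly_eqI_degree[of "mu ` {1..N}"]) (auto simp: D_def)
    then show ?thesis by (simp add: D_def)
  qed
  moreover have "a = (\<Sum>j=1..Suc N. lam j) - (\<Sum>j=1..N. mu j) \<and>
    (\<forall>k\<in>{1..N}. poly X (mu k) = - poly G (mu k))" if eq: "[:- a, 1:] * P - G = X"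
  proof
    have "coeff P M - a - coeff G N = coeff X N"
      unfolding eq[symmetric] coeff_diff aPN ..
    then show "a = (\<Sum>j=1..Suc N. lam j) - (\<Sum>j=1..N. mu j)"
      unfolding P1 X1 by (simp add: GN algebra_simps)
    show "\<forall>k\<in>{1..N}. poly X (mu k) = - poly G (mu k)"
      unfolding eq[symmetric] using P0 by simp
  qed
  ultimately show ?thesis unfolding P_def X_def by blast
qed

lemma char_poly_hatJ_mat:
  fixes c b :: "nat \<Rightarrow> real"
  assumes N: "N \<ge> 2"
  shows "char_poly (hatJ_mat (Suc N) c b a bn) =
    [:- a, 1:] * map_poly of_real (jacobi_poly c b 1 N)
      - Polynomial.smult (bn * cnj bn) (map_poly of_real (jacobi_poly c b 2 (N - 1)))
      - Polynomial.smult ((of_real (b N))\<^sup>2) (map_poly of_real (jacobi_poly c b 1 (N - 1)))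
      - [:(bn + cnj bn) * (\<Prod>k=1..N. of_real (b k)):]"
proof -
  have "char_poly_matrix (hatJ_mat (Suc N) c b a bn) =
      corner_pencil N (\<lambda>k. of_real (c k)) (\<lambda>k. of_real (b k)) a bn (cnj bn)"
    by (rule eq_matI) (use N in \<open>auto simp: char_poly_matrix_def hatJ_mat_def corner_pencil_def\<close>)
  then show ?thesis
    by (simp only: char_poly_def det_corner_pencil[OF N] map_poly_of_real_jacobi_poly)
qed

lemma char_poly_leading_minor_hatJ_mat:
  "char_poly (leading_minor_mat (hatJ_mat (Suc N) c b a bn)) = map_poly of_real (jacobi_poly c b 1 N)"
proof -
  have "char_poly_matrix (leading_minor_mat (hatJ_mat (Suc N) c b a bn)) =
      jacobi_pencil (\<lambda>k. of_real (c k)) (\<lambda>k. of_real (b k)) 1 N"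
    by (rule eq_matI)
       (auto simp: char_poly_matrix_def leading_minor_mat_def mat_delete_def hatJ_mat_def jacobi_pencil_def)
  then show ?thesis
    by (simp only: char_poly_def det_jacobi_pencil map_poly_of_real_jacobi_poly)
qed

lemma spectrum_mset_eq_iff:
  assumes A: "A \<in> carrier_mat m m" and "finite S"
  shows "spectrum_mset A = image_mset f (mset_set S) \<longleftrightarrow> char_poly A = (\<Prod>j\<in>S. [:- f j, 1:])"
proof
  assume "spectrum_mset A = image_mset f (mset_set S)"
  then have "(\<Prod>x\<in>#proots (char_poly A). [:- x, 1:]) = (\<Prod>j\<in>S. [:- f j, 1:])"
    by (simp add: spectrum_mset_def prod_unfold_prod_mset multiset.map_comp comp_def)
  then show "char_poly A = (\<Prod>j\<in>S. [:- f j, 1:])"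
    using complex_poly_decompose_multiset[of "char_poly A"] degree_monic_char_poly[OF A] by simp
next
  assume "char_poly A = (\<Prod>j\<in>S. [:- f j, 1:])"
  then have "spectrum_mset A = (\<Sum>j\<in>S. {#f j#})"
    by (simp add: spectrum_mset_def proots_prod)
  also have "\<dots> = image_mset f (mset_set S)"
    using \<open>finite S\<close> by (induction S) auto
  finally show "spectrum_mset A = image_mset f (mset_set S)" .
qed

text \<open>
  The spectral conditions on the real parameters, with \<open>r\<close> standing for the corner entry
  \<open>b\<^sub>n\<close>, which is real because the product of all \<open>b\<^sub>k\<close> is. The last clause is the
  characteristic polynomial of the full matrix at the nodes, where the unknown diagonal entry drops out.
\<close>
definition admissible ::
    "nat \<Rightarrow> (nat \<Rightarrow> complex) \<Rightarrow> (nat \<Rightarrow> real) \<Rightarrow> real \<Rightarrow>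
     (nat \<Rightarrow> real) \<Rightarrow> (nat \<Rightarrow> real) \<Rightarrow> real \<Rightarrow> bool" where
  "admissible N lam mu \<beta> c b r \<longleftrightarrow>
     r * (\<Prod>k=1..N. b k) = \<beta> \<and>
     jacobi_poly c b 1 N = (\<Prod>j=1..N. [:- mu j, 1:]) \<and>
     (\<forall>k\<in>{1..N}. chi (Suc N) lam (of_real (mu k)) =
        - of_real (r\<^sup>2 * poly (jacobi_poly c b 2 (N - 1)) (mu k)
                 + (b N)\<^sup>2 * poly (jacobi_poly c b 1 (N - 1)) (mu k) + 2 * \<beta>))"

text \<open>
  The last diagonal entry as the difference of the traces of the matrix and of its leading minor.
\<close>
definition corner_entry :: "nat \<Rightarrow> (nat \<Rightarrow> complex) \<Rightarrow> (nat \<Rightarrow> real) \<Rightarrow> complex" where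
  "corner_entry N lam mu = (\<Sum>j=1..Suc N. lam j) - (\<Sum>j=1..N. of_real (mu j))"

lemma map_poly_of_real_linear_prod:
  "map_poly complex_of_real (\<Prod>j\<in>A. [:- mu j, 1:]) = (\<Prod>j\<in>A. [:- of_real (mu j), 1:])"
proof -
  interpret h: map_poly_comm_ring_hom complex_of_real ..
  show ?thesis by (induction A rule: infinite_finite_induct) (simp_all add: h.hom_mult del: mult_pCons_left)
qed

lemma hatJ_mat_mem_hatJ_data_iff:
  fixes r :: real
  assumes N: "N \<ge> 2" and mu: "inj_on mu {1..N}" and \<beta>: "\<beta> \<noteq> 0"
  shows "hatJ_mat (Suc N) c b a (of_real r) \<in> hatJ_data (Suc N) lam mu \<beta> \<longleftrightarrow>
    a = corner_entry N lam mu \<and> admissible N lam mu \<beta> c b r"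
proof -
  let ?J = "hatJ_mat (Suc N) c b a (of_real r)"
  let ?P = "\<Prod>j=1..N. [:- mu j, 1:]" and ?X = "\<Prod>j=1..Suc N. [:- lam j, 1:]"
  have J: "?J \<in> carrier_mat (Suc N) (Suc N)" by (simp add: hatJ_mat_def)
  have J': "leading_minor_mat ?J \<in> carrier_mat N N"
    using mat_delete_carrier[OF J] J by (simp add: leading_minor_mat_def)
  have "spectrum_mset (leading_minor_mat ?J) = image_mset (\<lambda>k. of_real (mu k)) (mset_set {1..N})
      \<longleftrightarrow> map_poly complex_of_real (jacobi_poly c b 1 N) = map_poly of_real ?P"
    unfolding spectrum_mset_eq_iff[OF J' finite_atLeastAtMost] char_poly_leading_minor_hatJ_mat
      map_poly_of_real_linear_prod ..
  then have minor: "spectrum_mset (leading_minor_mat ?J) =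
      image_mset (\<lambda>k. of_real (mu k)) (mset_set {1..N}) \<longleftrightarrow> jacobi_poly c b 1 N = ?P"
    by (simp add: poly_eq_iff coeff_map_poly)
  have "(\<Prod>k=1..N. hat_b ?J k) = (\<Prod>k=1..N. of_real (b k))"
    using N by (intro prod.cong) (auto simp: hat_b_hatJ_mat)
  moreover have "hat_b ?J (Suc N) = of_real r"
    using N hat_b_hatJ_mat(2)[of "Suc N" c b a "of_real r"] by simp
  ultimately have "(\<Prod>k=1..Suc N. hat_b ?J k) = of_real (r * (\<Prod>k=1..N. b k))"
    by simp
  then have prod: "(\<Prod>k=1..Suc N. hat_b ?J k) = of_real \<beta> \<longleftrightarrow> r * (\<Prod>k=1..N. b k) = \<beta>"
    by (simp only: of_real_eq_iff)
  have full: "spectrum_mset ?J = image_mset lam (mset_set {1..Suc N}) \<longleftrightarrow>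
      a = corner_entry N lam mu \<and> admissible N lam mu \<beta> c b r"
    if b: "r * (\<Prod>k=1..N. b k) = \<beta>" and P: "jacobi_poly c b 1 N = ?P"
  proof -
    have mu': "inj_on (\<lambda>j. complex_of_real (mu j)) {1..N}"
      using mu unfolding inj_on_def of_real_eq_iff .
    define G where "G = Polynomial.smult (of_real (r\<^sup>2)) (map_poly complex_of_real (jacobi_poly c b 2 (N - 1)))
      + Polynomial.smult (of_real ((b N)\<^sup>2)) (map_poly of_real (jacobi_poly c b 1 (N - 1)))
      + [:of_real (2 * \<beta>):]"
    have dK: "degree (map_poly complex_of_real (jacobi_poly c b l (N - 1))) = N - 1" for l
      by (simp add: jacobi_poly_monic degree_map_poly)
    have G: "degree G < N"
      unfolding G_def using N dK
      by (intro degree_add_less le_less_trans[OF degree_smult_le]) auto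
    have "char_poly ?J = [:- a, 1:] * (\<Prod>j=1..N. [:- of_real (mu j), 1:]) - G"
      unfolding char_poly_hatJ_mat[OF N] P map_poly_of_real_linear_prod G_def b[symmetric]
      by (simp add: power2_eq_square algebra_simps del: mult_pCons_left)
    then have "spectrum_mset ?J = image_mset lam (mset_set {1..Suc N}) \<longleftrightarrow>
        [:- a, 1:] * (\<Prod>j=1..N. [:- of_real (mu j), 1:]) - G = ?X"
      by (simp only: spectrum_mset_eq_iff[OF J finite_atLeastAtMost])
    also have "\<dots> \<longleftrightarrow> a = corner_entry N lam mu \<and>
        (\<forall>k\<in>{1..N}. poly ?X (of_real (mu k)) = - poly G (of_real (mu k)))"
      unfolding corner_entry_def
      by (rule monic_eq_by_nodes_iff[OF mu' _ G]) (use N in simp)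
    also have "(\<forall>k\<in>{1..N}. poly ?X (of_real (mu k)) = - poly G (of_real (mu k))) \<longleftrightarrow>
        admissible N lam mu \<beta> c b r"
    proof -
      have "poly ?X z = chi (Suc N) lam z" for z
        unfolding chi_def poly_prod by (rule prod.cong) simp_all
      moreover have "poly G (of_real x) = of_real (r\<^sup>2 * poly (jacobi_poly c b 2 (N - 1)) x
                 + (b N)\<^sup>2 * poly (jacobi_poly c b 1 (N - 1)) x + 2 * \<beta>)" for x
        by (simp add: G_def)
      ultimately show ?thesis
        unfolding admissible_def using b P by simp
    qed
    finally show ?thesis .
  qed
  have "?J \<in> hatJ_class (Suc N)" if "r * (\<Prod>k=1..N. b k) = \<beta>"
  proof -
    have "complex_of_real r \<noteq> 0" using that \<beta> by auto
    then show ?thesis unfolding hatJ_class_def by blast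
  qed
  then have "?J \<in> hatJ_data (Suc N) lam mu \<beta> \<longleftrightarrow>
      r * (\<Prod>k=1..N. b k) = \<beta> \<and> jacobi_poly c b 1 N = ?P \<and>
      spectrum_mset ?J = image_mset lam (mset_set {1..Suc N})"
    unfolding hatJ_data_def mem_Collect_eq prod diff_Suc_1 minor by blast
  then show ?thesis
    using full unfolding admissible_def by blast
qed

lemma hatJ_data_cases:
  assumes N: "N \<ge> 2" and mu: "inj_on mu {1..N}" and \<beta>: "\<beta> \<noteq> 0"
    and J: "J \<in> hatJ_data (Suc N) lam mu \<beta>"
  obtains c b r where "J = hatJ_mat (Suc N) c b (corner_entry N lam mu) (of_real r)"
    "admissible N lam mu \<beta> c b r"
proof -
  obtain c b a bn where J_eq: "J = hatJ_mat (Suc N) c b a bn"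
    using J by (auto simp: hatJ_data_def hatJ_class_def)
  have "(\<Prod>k=1..N. hat_b J k) = (\<Prod>k=1..N. of_real (b k))"
    using N unfolding J_eq by (intro prod.cong) (auto simp: hat_b_hatJ_mat)
  moreover have "hat_b J (Suc N) = bn"
    using N hat_b_hatJ_mat(2)[of "Suc N" c b a bn] by (simp add: J_eq)
  ultimately have "of_real (\<Prod>k=1..N. b k) * bn = of_real \<beta>"
    using J by (simp add: hatJ_data_def)
  moreover from this have "(\<Prod>k=1..N. b k) \<noteq> 0"
    using \<beta> by (metis mult_eq_0_iff of_real_0 of_real_eq_iff)
  ultimately have "bn = of_real (\<beta> / (\<Prod>k=1..N. b k))"
    by (simp add: field_simps)
  then show ?thesis
    using that[of c b] J hatJ_mat_mem_hatJ_data_iff[OF N mu \<beta>] unfolding J_eq by metis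
qed

text \<open>
  The contributions of the two border entries to the value at a node are positive after
  multiplication by the alternating sign, and their product is \<open>\<beta>\<^sup>2\<close>: the first by
  interlacing, the second by the Casorati identity.
\<close>
lemma admissible_node_values:
  fixes mu :: "nat \<Rightarrow> real"
  assumes N: "N \<ge> 2" and mu: "strict_mono_on {1..N} mu" and \<beta>: "\<beta> \<noteq> 0"
    and b: "r * (\<Prod>k=1..N. b k) = \<beta>"
    and P: "jacobi_poly c b 1 N = (\<Prod>j=1..N. [:- mu j, 1:])"
    and k: "k \<in> {1..N}"
  defines "x \<equiv> (- 1) ^ (N - k) * r\<^sup>2 * poly (jacobi_poly c b 2 (N - 1)) (mu k)"
  shows "0 < x" "(- 1) ^ (N - k) * ((b N)\<^sup>2 * poly (jacobi_poly c b 1 (N - 1)) (mu k)) = \<beta>\<^sup>2 / x"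
proof -
  have nz: "r \<noteq> 0" "\<forall>l\<in>{1..N}. b l \<noteq> 0"
  proof -
    have "r \<noteq> 0 \<and> (\<Prod>k=1..N. b k) \<noteq> 0" using b \<beta> by auto
    then show "r \<noteq> 0" "\<forall>l\<in>{1..N}. b l \<noteq> 0" by auto
  qed
  obtain M where M: "N = M + 2" using N by (metis le_add_diff_inverse2)
  have q: "0 < (- 1) ^ (N - k) * poly (jacobi_poly c b (1 + 1) (N - 1)) (mu k)"
    by (rule jacobi_poly_interlacing[OF mu k _ P]) (use nz in auto)
  have "0 < r\<^sup>2 * ((- 1) ^ (N - k) * poly (jacobi_poly c b (1 + 1) (N - 1)) (mu k))"
    by (rule mult_pos_pos[OF _ q]) (use nz in simp)
  then show x: "0 < x" by (simp add: x_def mult_ac numeral_2_eq_2)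
  have "poly (jacobi_poly c b 1 N) (mu k) = 0"
    using k unfolding P by (auto simp: poly_prod intro!: bexI[of _ k])
  then have "poly (jacobi_poly c b 2 (N - 1)) (mu k) * poly (jacobi_poly c b 1 (N - 1)) (mu k)
      = (\<Prod>l=1..N-1. (b l)\<^sup>2)"
    using arg_cong[OF jacobi_poly_casorati[of c b 1 M], of "\<lambda>p. poly p (mu k)"]
    unfolding M by (simp add: numeral_2_eq_2)
  then have "x * ((- 1) ^ (N - k) * ((b N)\<^sup>2 * poly (jacobi_poly c b 1 (N - 1)) (mu k)))
      = r\<^sup>2 * ((b N)\<^sup>2 * (\<Prod>l=1..N-1. (b l)\<^sup>2))"
    by (simp add: x_def mult_ac flip: power_add mult_2)
  also have "\<dots> = \<beta>\<^sup>2"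
    unfolding b[symmetric] M by (simp add: power_mult_distrib prod_power_distrib mult_ac)
  finally show "(- 1) ^ (N - k) * ((b N)\<^sup>2 * poly (jacobi_poly c b 1 (N - 1)) (mu k)) = \<beta>\<^sup>2 / x"
    using x by (simp add: field_simps)
qed

text \<open>
  The admissible values of the contribution \<open>x\<close> of \<open>b\<^sub>n\<close> at the \<open>k\<close>-th node; the one of
  \<open>b\<^sub>N\<close> is then \<open>\<beta>\<^sup>2 / x\<close>.
\<close>
definition node_weights ::
    "nat \<Rightarrow> (nat \<Rightarrow> complex) \<Rightarrow> (nat \<Rightarrow> real) \<Rightarrow> real \<Rightarrow> nat \<Rightarrow> real set" where
  "node_weights N lam mu \<beta> k = {x. 0 < x \<and>
     of_real (x + \<beta>\<^sup>2 / x) = (- 1) ^ (N - k) * (- chi (Suc N) lam (of_real (mu k)) - of_real (2 * \<beta>))}"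

lemma admissible_node_weights:
  assumes N: "N \<ge> 2" and mu: "strict_mono_on {1..N} mu" and \<beta>: "\<beta> \<noteq> 0"
    and adm: "admissible N lam mu \<beta> c b r" and k: "k \<in> {1..N}"
  shows "(- 1) ^ (N - k) * r\<^sup>2 * poly (jacobi_poly c b 2 (N - 1)) (mu k) \<in> node_weights N lam mu \<beta> k"
proof -
  let ?Q = "poly (jacobi_poly c b 2 (N - 1)) (mu k)" and ?R = "poly (jacobi_poly c b 1 (N - 1)) (mu k)"
  define e :: real where "e = (- 1) ^ (N - k)"
  define x where "x = e * r\<^sup>2 * ?Q"
  have b: "r * (\<Prod>k=1..N. b k) = \<beta>" and P: "jacobi_poly c b 1 N = (\<Prod>j=1..N. [:- mu j, 1:])"
    using adm unfolding admissible_def by blast+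
  have x: "0 < x" and y: "e * ((b N)\<^sup>2 * ?R) = \<beta>\<^sup>2 / x"
    using admissible_node_values[OF N mu \<beta> b P k] unfolding x_def e_def by blast+
  have "- chi (Suc N) lam (of_real (mu k)) - of_real (2 * \<beta>) = of_real (r\<^sup>2 * ?Q + (b N)\<^sup>2 * ?R)"
    using adm k by (simp add: admissible_def)
  then have "of_real e * (- chi (Suc N) lam (of_real (mu k)) - of_real (2 * \<beta>))
      = of_real (e * (r\<^sup>2 * ?Q + (b N)\<^sup>2 * ?R))"
    by simp
  also have "e * (r\<^sup>2 * ?Q + (b N)\<^sup>2 * ?R) = x + \<beta>\<^sup>2 / x"
    unfolding y[symmetric] by (simp add: x_def algebra_simps)
  finally show ?thesis
    using x unfolding node_weights_def x_def e_def by simp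
qed

lemma prod_split_last:
  fixes f :: "nat \<Rightarrow> 'a::comm_monoid_mult"
  assumes "1 \<le> N"
  shows "(\<Prod>k=1..N. f k) = (\<Prod>k=1..N-1. f k) * f N"
  using assms by (cases N) auto

text \<open>
  The weights are, up to alternating signs, the node values of \<open>r\<^sup>2 Q\<close> with \<open>Q\<close> monic of
  degree \<open>N - 1\<close>. Interpolation recovers this product; its top coefficient is positive and must be
  \<open>r\<^sup>2\<close>. The inverse problem then yields \<open>c\<close> and \<open>b\<^sub>1, \<dots>, b\<^sub>N\<^sub>-\<^sub>1 > 0\<close>, and the prescribed
  product yields \<open>b\<^sub>N\<close>, which is positive if \<open>r\<close> is given the sign of \<open>\<beta>\<close>.
\<close>
lemma admissible_exists:
  assumes N: "N \<ge> 2" and mu: "strict_mono_on {1..N} mu" and \<beta>: "\<beta> \<noteq> 0"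
    and x: "\<And>k. k \<in> {1..N} \<Longrightarrow> x k \<in> node_weights N lam mu \<beta> k"
  shows "\<exists>c b r. admissible N lam mu \<beta> c b r \<and> (\<forall>k\<in>{1..N}. 0 < b k) \<and>
    (\<forall>k\<in>{1..N}. (- 1) ^ (N - k) * r\<^sup>2 * poly (jacobi_poly c b 2 (N - 1)) (mu k) = x k)"
proof -
  define e :: "nat \<Rightarrow> real" where "e k = (- 1) ^ (N - k)" for k
  have e2: "e k * e k = 1" for k
    by (simp add: e_def flip: power_add mult_2)
  have pos: "0 < x k" if "k \<in> {1..N}" for k
    using x[OF that] by (simp add: node_weights_def)
  obtain S where S: "degree S \<le> N - 1" "\<And>k. k \<in> {1..N} \<Longrightarrow> poly S (mu k) = e k * x k"
    "coeff S (N - 1) = (\<Sum>k=1..N. e k * x k / (\<Prod>j\<in>{1..N} - {k}. mu k - mu j))"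
    using lagrange_interpolation[of "{1..N}" mu "\<lambda>k. e k * x k"] strict_mono_on_imp_inj_on[OF mu]
    by auto
  define \<rho> where "\<rho> = coeff S (N - 1)"
  have "0 < \<rho>"
    unfolding \<rho>_def S(3)
  proof (rule sum_pos)
    fix k assume k: "k \<in> {1..N}"
    have "0 < x k / (e k * (\<Prod>j\<in>{1..N} - {k}. mu k - mu j))"
      unfolding e_def by (intro divide_pos_pos pos sgn_node_prod mu k)
    also have "\<dots> = (e k * x k) / ((e k * e k) * (\<Prod>j\<in>{1..N} - {k}. mu k - mu j))"
      by (cases "even (N - k)") (simp_all add: e_def)
    finally show "0 < e k * x k / (\<Prod>j\<in>{1..N} - {k}. mu k - mu j)"
      by (simp add: e2)
  qed (use N in auto)
  define Q where "Q = Polynomial.smult (1 / \<rho>) S"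
  have N1: "Suc (N - 1) = N" and "1 \<le> N" using N by auto
  have Q: "degree Q = N - 1" "coeff Q (N - 1) = 1"
    using \<open>0 < \<rho>\<close> S(1) le_degree[of S "N - 1"] by (auto simp: Q_def \<rho>_def)
  have "0 < (- 1) ^ (N - k) * poly Q (mu k)" if k: "k \<in> {1..N}" for k
    using pos[OF k] \<open>0 < \<rho>\<close> e2[of k] by (simp add: Q_def S(2)[OF k] e_def flip: mult.assoc)
  then obtain c b where b: "\<And>k. 0 < b k"
    and P: "jacobi_poly c b 1 N = (\<Prod>j=1..N. [:- mu j, 1:])" and QK: "jacobi_poly c b (Suc 1) (N - 1) = Q"
    using jacobi_inverse_exists[of "N - 1" mu Q 1, unfolded N1, OF mu Q] by blast
  \<comment> \<open>this sign of \<open>r\<close> makes the last off-diagonal entry below positive\<close>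
  define r where "r = sgn \<beta> * sqrt \<rho>"
  have r2: "r\<^sup>2 = \<rho>"
    using \<open>0 < \<rho>\<close> \<beta> by (simp add: r_def power_mult_distrib sgn_if)
  define \<pi> where "\<pi> = (\<Prod>k=1..N-1. b k)"
  have "0 < \<pi>" unfolding \<pi>_def by (intro prod_pos) (use b in auto)
  define b' where "b' = b(N := \<beta> / (r * \<pi>))"
  have "\<beta> / (r * \<pi>) = \<bar>\<beta>\<bar> / (sqrt \<rho> * \<pi>)"
    using \<beta> by (simp add: r_def sgn_if)
  then have b': "0 < b' k" for k
    using b \<beta> \<open>0 < \<rho>\<close> \<open>0 < \<pi>\<close> by (auto simp: b'_def)
  have "(\<Prod>k=1..N. b' k) = \<pi> * (\<beta> / (r * \<pi>))"
  proof -
    have "(\<Prod>k=1..N-1. b' k) = \<pi>"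
      unfolding \<pi>_def by (rule prod.cong) (use N in \<open>auto simp: b'_def\<close>)
    then show ?thesis
      unfolding prod_split_last[OF \<open>1 \<le> N\<close>] by (simp add: b'_def)
  qed
  then have prod: "r * (\<Prod>k=1..N. b' k) = \<beta>"
    using \<open>0 < \<pi>\<close> r2 \<open>0 < \<rho>\<close> by auto
  have K: "jacobi_poly c b' 1 N = jacobi_poly c b 1 N"
      "jacobi_poly c b' 2 (N - 1) = jacobi_poly c b (Suc 1) (N - 1)"
    by (auto intro!: jacobi_poly_cong simp: b'_def numeral_2_eq_2)
  have Qx: "e k * r\<^sup>2 * poly (jacobi_poly c b' 2 (N - 1)) (mu k) = x k" if k: "k \<in> {1..N}" for k
    unfolding K QK using \<open>0 < \<rho>\<close> e2[of k] by (simp add: Q_def S(2)[OF k] r2 flip: mult.assoc)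
  have "chi (Suc N) lam (of_real (mu k)) =
        - of_real (r\<^sup>2 * poly (jacobi_poly c b' 2 (N - 1)) (mu k)
                 + (b' N)\<^sup>2 * poly (jacobi_poly c b' 1 (N - 1)) (mu k) + 2 * \<beta>)"
    if k: "k \<in> {1..N}" for k
  proof -
    let ?q = "r\<^sup>2 * poly (jacobi_poly c b' 2 (N - 1)) (mu k)"
    let ?y = "(b' N)\<^sup>2 * poly (jacobi_poly c b' 1 (N - 1)) (mu k)"
    have y: "e k * ?y = \<beta>\<^sup>2 / x k"
      using admissible_node_values(2)[OF N mu \<beta> prod P[folded K] k] Qx[OF k]
      unfolding e_def by simp
    have "of_real (x k + \<beta>\<^sup>2 / x k) =
        of_real (e k) * (- chi (Suc N) lam (of_real (mu k)) - of_real (2 * \<beta>))"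
      using x[OF k] by (simp add: node_weights_def e_def)
    then have "of_real (e k) * of_real (x k + \<beta>\<^sup>2 / x k) =
        of_real (e k * e k) * (- chi (Suc N) lam (of_real (mu k)) - of_real (2 * \<beta>))"
      by (simp only: of_real_mult mult.assoc)
    then have "- chi (Suc N) lam (of_real (mu k)) - of_real (2 * \<beta>) =
        of_real (e k * (x k + \<beta>\<^sup>2 / x k))"
      by (simp add: e2)
    also have "e k * (x k + \<beta>\<^sup>2 / x k) = e k * (e k * ?q + e k * ?y)"
      unfolding y Qx[OF k, symmetric] by (simp only: mult.assoc)
    also have "\<dots> = ?q + ?y"
      using e2[of k] by (simp add: algebra_simps flip: mult.assoc)
    finally have F: "- chi (Suc N) lam (of_real (mu k)) - of_real (2 * \<beta>) = of_real (?q + ?y)" .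
    have "chi (Suc N) lam (of_real (mu k)) =
        - (- chi (Suc N) lam (of_real (mu k)) - of_real (2 * \<beta>)) - of_real (2 * \<beta>)"
      by simp
    then show ?thesis unfolding F by simp
  qed
  then have "admissible N lam mu \<beta> c b' r"
    unfolding admissible_def using prod P K by simp
  then show ?thesis
    using b' Qx unfolding e_def by blast
qed

lemma admissible_unique:
  assumes N: "N \<ge> 2" and mu: "inj_on mu {1..N}" and \<beta>: "\<beta> \<noteq> 0"
    and adm: "admissible N lam mu \<beta> c b r" "admissible N lam mu \<beta> c' b' r'"
    and pos: "\<And>k. k \<in> {1..N} \<Longrightarrow> 0 < b k" "\<And>k. k \<in> {1..N} \<Longrightarrow> 0 < b' k"
    and eq: "\<And>k. k \<in> {1..N} \<Longrightarrow> r\<^sup>2 * poly (jacobi_poly c b 2 (N - 1)) (mu k)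
      = r'\<^sup>2 * poly (jacobi_poly c' b' 2 (N - 1)) (mu k)"
  shows "r = r' \<and> (\<forall>k\<in>{1..N}. c k = c' k \<and> b k = b' k)"
proof -
  have N1: "Suc (N - 1) = N" using N by simp
  let ?Q = "jacobi_poly c b 2 (N - 1)" and ?Q' = "jacobi_poly c' b' 2 (N - 1)"
  have Q: "Polynomial.smult (r\<^sup>2) ?Q = Polynomial.smult (r'\<^sup>2) ?Q'"
  proof (rule poly_eqI_degree[of "mu ` {1..N}"])
    show "degree (Polynomial.smult (r\<^sup>2) ?Q) < card (mu ` {1..N})"
      "degree (Polynomial.smult (r'\<^sup>2) ?Q') < card (mu ` {1..N})"
      using N by (auto simp: card_image[OF mu[simplified]] jacobi_poly_monic)
  qed (use eq in auto)
  have r2: "r\<^sup>2 = r'\<^sup>2"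
    using arg_cong[OF Q, of "\<lambda>p. coeff p (N - 1)"] by (simp add: jacobi_poly_monic del: One_nat_def)
  have prod: "r * (\<Prod>k=1..N. b k) = \<beta>" "r' * (\<Prod>k=1..N. b' k) = \<beta>"
    using adm by (auto simp: admissible_def)
  have bpos: "0 < (\<Prod>k=1..N. b k)" "0 < (\<Prod>k=1..N. b' k)"
    by (intro prod_pos pos; simp)+
  have "sgn (r * (\<Prod>k=1..N. b k)) = sgn (r' * (\<Prod>k=1..N. b' k))"
    unfolding prod ..
  then have "sgn r = sgn r'"
    using bpos by (simp add: sgn_mult)
  moreover have "\<bar>r\<bar> = \<bar>r'\<bar>" using r2 by (simp add: power2_eq_iff abs_eq_iff)
  ultimately have r: "r = r'"
    by (metis sgn_mult_abs)
  have "r \<noteq> 0" using prod \<beta> by auto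
  have "Polynomial.smult (r\<^sup>2) (?Q - ?Q') = 0"
    using Q r by (simp add: smult_diff_right)
  then have "?Q = ?Q'" using \<open>r \<noteq> 0\<close> by simp
  then have QQ: "jacobi_poly c b (Suc 1) (N - 1) = jacobi_poly c' b' (Suc 1) (N - 1)"
    by (simp add: numeral_2_eq_2)
  have PP: "jacobi_poly c b 1 (Suc (N - 1)) = jacobi_poly c' b' 1 (Suc (N - 1))"
    using adm unfolding admissible_def N1 by metis
  have *: "(\<forall>k. 1 \<le> k \<and> k \<le> 1 + (N - 1) \<longrightarrow> c k = c' k) \<and> (\<forall>k. 1 \<le> k \<and> k < 1 + (N - 1) \<longrightarrow> b k = b' k)"
    by (rule jacobi_inverse_unique[OF PP QQ]) (use pos in auto)
  have "(\<Prod>k=1..N. b k) = (\<Prod>k=1..N. b' k)"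
    using prod r \<open>r \<noteq> 0\<close> by auto
  moreover have "(\<Prod>k=1..N. f k) = (\<Prod>k=1..N-1. f k) * f N" for f :: "nat \<Rightarrow> real"
    using N by (intro prod_split_last) simp
  moreover have "(\<Prod>k=1..N-1. b k) = (\<Prod>k=1..N-1. b' k)"
    using * N by (intro prod.cong) auto
  moreover have "0 < (\<Prod>k=1..N-1. b' k)"
    by (intro prod_pos) (use pos in auto)
  ultimately have "b N = b' N" by (metis mult_cancel_left less_irrefl)
  then show ?thesis
    using r * N by (metis N1 atLeastAtMost_iff le_eq_less_or_eq plus_1_eq_Suc)
qed

section \<open>Counting the weights at the nodes\<close>

text \<open>
  The equation is quadratic with discriminant \<open>h\<^sup>2 - 4 g\<^sup>2\<close>, and its roots have product
  \<open>g\<^sup>2\<close>; the bound in the first part is the inequality of arithmetic and geometric means.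
\<close>
lemma reciprocal_sum_solutions:
  fixes g h :: real
  assumes g: "0 < g"
  defines "A \<equiv> {x. 0 < x \<and> x + g\<^sup>2 / x = h}"
  shows "x \<in> A \<Longrightarrow> 2 * g \<le> h"
    and "2 * g \<le> h \<Longrightarrow> finite A \<and> card A = (if h = 2 * g then 1 else 2)"
proof -
  have quad: "x + g\<^sup>2 / x = h \<longleftrightarrow> (2 * x - h)\<^sup>2 = h\<^sup>2 - 4 * g\<^sup>2" if "0 < x" for x
  proof -
    have "x + g\<^sup>2 / x = h \<longleftrightarrow> x * x + g * g - h * x = 0"
      using that by (auto simp: field_simps power2_eq_square)
    moreover have d4: "(2 * x - h)\<^sup>2 - (h\<^sup>2 - 4 * g\<^sup>2) = 4 * (x * x + g * g - h * x)"
      by (simp add: algebra_simps power2_eq_square)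
    have "(2 * x - h)\<^sup>2 = h\<^sup>2 - 4 * g\<^sup>2 \<longleftrightarrow> x * x + g * g - h * x = 0"
      unfolding eq_iff_diff_eq_0[of "(2 * x - h)\<^sup>2"] d4 mult_eq_0_iff by simp
    ultimately show ?thesis by blast
  qed
  show "2 * g \<le> h" if "x \<in> A"
  proof -
    have "0 < x" and h: "h = x + g\<^sup>2 / x" using that by (auto simp: A_def)
    then have "h - 2 * g = (x - g)\<^sup>2 / x"
      by (simp add: field_simps power2_eq_square)
    also have "\<dots> \<ge> 0" using \<open>0 < x\<close> by simp
    finally show ?thesis by simp
  qed
  show "finite A \<and> card A = (if h = 2 * g then 1 else 2)" if h: "2 * g \<le> h"
  proof -
    define s where "s = sqrt (h\<^sup>2 - 4 * g\<^sup>2)"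
    have "(2 * g)\<^sup>2 \<le> h\<^sup>2" using h g by (intro power_mono) auto
    then have s2: "s\<^sup>2 = h\<^sup>2 - 4 * g\<^sup>2" by (simp add: s_def power_mult_distrib)
    have "s < h"
      using g h unfolding s_def by (intro real_less_lsqrt) auto
    have "0 \<le> s" using s2 \<open>(2 * g)\<^sup>2 \<le> h\<^sup>2\<close> by (simp add: s_def power_mult_distrib)
    have "A = {(h + s) / 2, (h - s) / 2}"
    proof (intro equalityI subsetI)
      fix x assume "x \<in> A"
      then have "(2 * x - h)\<^sup>2 = s\<^sup>2" unfolding A_def s2 using quad by blast
      then show "x \<in> {(h + s) / 2, (h - s) / 2}"
        unfolding power2_eq_iff by auto
    next
      fix x assume "x \<in> {(h + s) / 2, (h - s) / 2}"
      then have "0 < x" "2 * x - h = s \<or> 2 * x - h = - s"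
        using \<open>s < h\<close> \<open>0 \<le> s\<close> by auto
      then have "0 < x" "(2 * x - h)\<^sup>2 = s\<^sup>2"
        unfolding power2_eq_iff by auto
      then show "x \<in> A" unfolding A_def s2 using quad by blast
    qed
    moreover have "s = 0 \<longleftrightarrow> h = 2 * g"
    proof -
      have "s = 0 \<longleftrightarrow> h\<^sup>2 = (2 * g)\<^sup>2" using s2 by (auto simp: power_mult_distrib s_def)
      moreover have "h\<^sup>2 = (2 * g)\<^sup>2 \<longleftrightarrow> h = 2 * g"
        unfolding power2_eq_iff using g h by auto
      ultimately show ?thesis by blast
    qed
    ultimately show ?thesis by auto
  qed
qed

text \<open>
  Let \<open>e = (-1)^(N - k)\<close>. If \<open>u = -e \<xi>\<close> is real, the equation for the weight is
  \<open>x + \<beta>\<^sup>2 / x = u - 2 e \<beta>\<close>, solvable iff the right side is at least \<open>2 \<bar>\<beta>\<bar>\<close>. If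
  \<open>e \<beta> < 0\<close> this says \<open>u \<ge> 0\<close>, and if \<open>e \<beta> > 0\<close> it says \<open>u \<ge> 4 e \<beta>\<close>. So one of the two
  inequalities of the theorem is the solvability condition at this node, the other one is then strict,
  and equality means a double solution.
\<close>
lemma node_weights_count:
  fixes N k lam mu and \<beta> :: real
  assumes \<beta>: "\<beta> \<noteq> 0" and k: "k \<in> {1..N}"
  defines "\<xi> \<equiv> chi (Suc N) lam (of_real (mu k))"
  defines "admits \<equiv> \<xi> \<in> \<real> \<and> (- 1) ^ (Suc N - k) * Re \<xi> \<ge> 0 \<and> cmod \<xi> \<ge> 4 * (- 1) ^ (Suc N - k - 1) * \<beta>"
  shows "x \<in> node_weights N lam mu \<beta> k \<Longrightarrow> admits"
    and "admits \<Longrightarrow> finite (node_weights N lam mu \<beta> k) \<and> card (node_weights N lam mu \<beta> k) =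
      (if \<xi> = 0 \<or> cmod \<xi> = 4 * (- 1) ^ (Suc N - k - 1) * \<beta> then 1 else 2)"
proof -
  define e :: real where "e = (- 1) ^ (N - k)"
  have e2: "e * e = 1" by (simp add: e_def flip: power_add mult_2)
  have abs_e: "\<bar>e\<bar> = 1" by (simp add: e_def)
  have e1: "(- 1 :: real) ^ (Suc N - k) = - e" "Suc N - k - 1 = N - k"
    using k by (auto simp: e_def Suc_diff_le)
  have eC: "(- 1 :: complex) ^ (N - k) = of_real e" by (simp add: e_def)
  have admits: "admits \<longleftrightarrow> \<xi> \<in> \<real> \<and> - e * Re \<xi> \<ge> 0 \<and> cmod \<xi> \<ge> 4 * (e * \<beta>)"
    unfolding admits_def e1 by (simp add: e_def mult_ac)
  have abs_s: "\<bar>e * \<beta>\<bar> = \<bar>\<beta>\<bar>" by (simp add: abs_mult abs_e)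
  show admits if "x \<in> node_weights N lam mu \<beta> k"
  proof -
    define h where "h = x + \<beta>\<^sup>2 / x"
    have x: "0 < x" and eq: "of_real h = of_real e * (- \<xi> - of_real (2 * \<beta>))"
      using that unfolding node_weights_def eC h_def \<xi>_def by auto
    have "2 * \<bar>\<beta>\<bar> \<le> h"
      using reciprocal_sum_solutions(1)[of "\<bar>\<beta>\<bar>" x h] \<beta> x by (simp add: h_def)
    have "of_real e * of_real h = of_real (e * e) * (- \<xi> - of_real (2 * \<beta>))"
      by (simp only: eq of_real_mult mult.assoc)
    then have F: "- \<xi> - of_real (2 * \<beta>) = of_real (e * h)"
      by (simp add: e2)
    have "\<xi> = - (- \<xi> - of_real (2 * \<beta>)) - of_real (2 * \<beta>)" by simp
    then have \<xi>: "\<xi> = of_real (- e * h - 2 * \<beta>)"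
      unfolding F by simp
    then have "Re \<xi> = - e * h - 2 * \<beta>"
      by simp
    then have "- e * Re \<xi> = - e * (- e * h - 2 * \<beta>)"
      by (simp only:)
    also have "\<dots> = (e * e) * h + 2 * (e * \<beta>)"
      by (simp add: algebra_simps)
    finally have Re: "- e * Re \<xi> = h + 2 * (e * \<beta>)"
      by (simp only: e2 mult_1)
    have "cmod \<xi> = \<bar>- e * Re \<xi>\<bar>"
      unfolding \<xi> norm_of_real by (simp add: abs_mult abs_e)
    moreover have bounds: "0 \<le> h + 2 * (e * \<beta>)" "4 * (e * \<beta>) \<le> h + 2 * (e * \<beta>)"
      using \<open>2 * \<bar>\<beta>\<bar> \<le> h\<close> abs_s by linarith+
    ultimately have "cmod \<xi> = h + 2 * (e * \<beta>)"
      unfolding Re by simp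
    moreover have "\<xi> \<in> \<real>" unfolding \<xi> by (rule Reals_of_real)
    ultimately show ?thesis
      unfolding admits Re using bounds by simp
  qed
  show "finite (node_weights N lam mu \<beta> k) \<and> card (node_weights N lam mu \<beta> k) =
      (if \<xi> = 0 \<or> cmod \<xi> = 4 * (- 1) ^ (Suc N - k - 1) * \<beta> then 1 else 2)" if admits
  proof -
    have "\<xi> \<in> \<real>" using that by (simp add: admits)
    then obtain t where t: "\<xi> = of_real t" by (rule Reals_cases)
    define u where "u = - e * t"
    have u: "0 \<le> u" "cmod \<xi> = u" "4 * (e * \<beta>) \<le> u"
    proof -
      show "0 \<le> u" using that by (simp add: admits u_def t)
      then show "cmod \<xi> = u" by (simp add: t u_def abs_mult abs_e abs_if split: if_splits) (use abs_e in \<open>auto simp: abs_if split: if_splits\<close>)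
      then show "4 * (e * \<beta>) \<le> u" using that by (simp add: admits)
    qed
    have "node_weights N lam mu \<beta> k = {x. 0 < x \<and> x + \<bar>\<beta>\<bar>\<^sup>2 / x = u - 2 * (e * \<beta>)}"
    proof -
      have "of_real e * (- \<xi> - of_real (2 * \<beta>)) = complex_of_real (u - 2 * (e * \<beta>))"
        by (simp add: t u_def algebra_simps)
      then show ?thesis
        unfolding node_weights_def eC \<xi>_def[symmetric] by (simp only: of_real_eq_iff power2_abs)
    qed
    moreover have "2 * \<bar>\<beta>\<bar> \<le> u - 2 * (e * \<beta>)"
      using u abs_s by (auto simp: abs_if split: if_splits)
    moreover have "u - 2 * (e * \<beta>) = 2 * \<bar>\<beta>\<bar> \<longleftrightarrow> \<xi> = 0 \<or> cmod \<xi> = 4 * (e * \<beta>)"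
    proof -
      have "\<xi> = 0 \<longleftrightarrow> u = 0" using u(2) by auto
      moreover have "e * \<beta> \<noteq> 0" using \<beta> abs_e by auto
      ultimately show ?thesis
        using u abs_s by (auto simp: abs_if mult.commute split: if_splits)
    qed
    moreover have "4 * (- 1) ^ (Suc N - k - 1) * \<beta> = 4 * (e * \<beta>)"
      unfolding e1 e_def by simp
    ultimately show ?thesis
      using reciprocal_sum_solutions(2)[of "\<bar>\<beta>\<bar>" "u - 2 * (e * \<beta>)"] \<beta> by simp
  qed
qed

section \<open>Positive representatives and sign similarity\<close>

definition positive_data ::
    "nat \<Rightarrow> (nat \<Rightarrow> complex) \<Rightarrow> (nat \<Rightarrow> real) \<Rightarrow> real \<Rightarrow> complex mat set" where
  "positive_data N lam mu \<beta> = {J \<in> hatJ_data (Suc N) lam mu \<beta>. \<forall>k\<in>{1..N}. Re (hat_b J k) > 0}"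

text \<open>
  The weights read off from the matrix entries. Restriction to \<open>{1..N}\<close> makes them elements of a
  product set, whose cardinality is the product of the numbers of solutions at the nodes.
\<close>
definition weights_of :: "nat \<Rightarrow> (nat \<Rightarrow> real) \<Rightarrow> complex mat \<Rightarrow> nat \<Rightarrow> real" where
  "weights_of N mu J = (\<lambda>k\<in>{1..N}. (- 1) ^ (N - k) * (Re (hat_b J (Suc N)))\<^sup>2 *
     poly (jacobi_poly (\<lambda>l. Re (J $$ (l - 1, l - 1))) (\<lambda>l. Re (hat_b J l)) 2 (N - 1)) (mu k))"

lemma weights_of_hatJ_mat:
  assumes N: "N \<ge> 2" and k: "k \<in> {1..N}"
  shows "weights_of N mu (hatJ_mat (Suc N) c b a (of_real r)) k =
    (- 1) ^ (N - k) * r\<^sup>2 * poly (jacobi_poly c b 2 (N - 1)) (mu k)"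
proof -
  let ?J = "hatJ_mat (Suc N) c b a (of_real r)"
  have "jacobi_poly (\<lambda>l. Re (?J $$ (l - 1, l - 1))) (\<lambda>l. Re (hat_b ?J l)) 2 (N - 1)
      = jacobi_poly c b 2 (N - 1)"
  proof (rule jacobi_poly_cong)
    show "Re (?J $$ (l - 1, l - 1)) = c l" if "2 \<le> l" "l < 2 + (N - 1)" for l
      using that by (auto simp: hatJ_mat_def)
    show "(Re (hat_b ?J l))\<^sup>2 = (b l)\<^sup>2" if "2 \<le> l" "l + 1 < 2 + (N - 1)" for l
      using that N by (simp add: hat_b_hatJ_mat)
  qed
  moreover have "hat_b ?J (Suc N) = of_real r"
    using N hat_b_hatJ_mat(2)[of "Suc N" c b a "of_real r"] by simp
  ultimately show ?thesis
    using k by (simp add: weights_of_def)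
qed

lemma positive_data_cases:
  assumes N: "N \<ge> 2" and mu: "inj_on mu {1..N}" and \<beta>: "\<beta> \<noteq> 0"
    and J: "J \<in> positive_data N lam mu \<beta>"
  obtains c b r where "J = hatJ_mat (Suc N) c b (corner_entry N lam mu) (of_real r)"
    "admissible N lam mu \<beta> c b r" "\<And>k. k \<in> {1..N} \<Longrightarrow> 0 < b k"
proof -
  have data: "J \<in> hatJ_data (Suc N) lam mu \<beta>" using J by (simp add: positive_data_def)
  obtain c b r where *: "J = hatJ_mat (Suc N) c b (corner_entry N lam mu) (of_real r)"
      "admissible N lam mu \<beta> c b r"
    using hatJ_data_cases[OF N mu \<beta> data] by blast
  have "0 < b k" if "k \<in> {1..N}" for k
    using J that N unfolding positive_data_def * by (auto simp: hat_b_hatJ_mat)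
  with * show ?thesis using that by blast
qed

text \<open>
  Injectivity and surjectivity are the uniqueness and the existence in the inverse problem. The point
  is that the target is a product: the weights at different nodes can be chosen independently.
\<close>
lemma bij_betw_weights_of:
  assumes N: "N \<ge> 2" and mu: "strict_mono_on {1..N} mu" and \<beta>: "\<beta> \<noteq> 0"
  shows "bij_betw (weights_of N mu) (positive_data N lam mu \<beta>)
    (PiE {1..N} (node_weights N lam mu \<beta>))"
proof (rule bij_betwI')
  note inj = strict_mono_on_imp_inj_on[OF mu]
  fix J assume J: "J \<in> positive_data N lam mu \<beta>"
  obtain c b r where J_eq: "J = hatJ_mat (Suc N) c b (corner_entry N lam mu) (of_real r)"
      and adm: "admissible N lam mu \<beta> c b r" and pos: "\<And>k. k \<in> {1..N} \<Longrightarrow> 0 < b k"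
    using positive_data_cases[OF N inj \<beta> J] by blast
  show "weights_of N mu J \<in> PiE {1..N} (node_weights N lam mu \<beta>)"
  proof (rule PiE_I)
    fix k assume "k \<in> {1..N}"
    then show "weights_of N mu J k \<in> node_weights N lam mu \<beta> k"
      unfolding J_eq weights_of_hatJ_mat[OF N \<open>k \<in> {1..N}\<close>]
      by (rule admissible_node_weights[OF N mu \<beta> adm])
  qed (auto simp: weights_of_def)
  fix K assume K: "K \<in> positive_data N lam mu \<beta>"
  obtain c' b' r' where K_eq: "K = hatJ_mat (Suc N) c' b' (corner_entry N lam mu) (of_real r')"
      and adm': "admissible N lam mu \<beta> c' b' r'" and pos': "\<And>k. k \<in> {1..N} \<Longrightarrow> 0 < b' k"
    using positive_data_cases[OF N inj \<beta> K] by blast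
  show "weights_of N mu J = weights_of N mu K \<longleftrightarrow> J = K"
  proof
    assume eq: "weights_of N mu J = weights_of N mu K"
    have eqs: "r\<^sup>2 * poly (jacobi_poly c b 2 (N - 1)) (mu k)
        = r'\<^sup>2 * poly (jacobi_poly c' b' 2 (N - 1)) (mu k)" if k: "k \<in> {1..N}" for k
      using fun_cong[OF eq, of k] unfolding J_eq K_eq weights_of_hatJ_mat[OF N k] by simp
    have "r = r' \<and> (\<forall>k\<in>{1..N}. c k = c' k \<and> b k = b' k)"
      by (rule admissible_unique[OF N inj \<beta> adm adm']) (erule pos pos' eqs)+
    then show "J = K"
      unfolding J_eq K_eq by (intro eq_matI) (auto simp: hatJ_mat_def)
  qed simp
next
  note inj = strict_mono_on_imp_inj_on[OF mu]
  fix x assume x: "x \<in> PiE {1..N} (node_weights N lam mu \<beta>)"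
  obtain c b r where adm: "admissible N lam mu \<beta> c b r" and pos: "\<forall>k\<in>{1..N}. 0 < b k"
      and xk: "\<forall>k\<in>{1..N}. (- 1) ^ (N - k) * r\<^sup>2 * poly (jacobi_poly c b 2 (N - 1)) (mu k) = x k"
    using admissible_exists[OF N mu \<beta>, of x lam] x by (auto simp: PiE_iff)
  define J where "J = hatJ_mat (Suc N) c b (corner_entry N lam mu) (of_real r)"
  have "J \<in> positive_data N lam mu \<beta>"
    using adm pos N by (auto simp: J_def positive_data_def hatJ_mat_mem_hatJ_data_iff[OF N inj \<beta>] hat_b_hatJ_mat)
  moreover have "x = weights_of N mu J"
  proof (rule extensionalityI[of _ "{1..N}"])
    show "x \<in> extensional {1..N}" "weights_of N mu J \<in> extensional {1..N}"
      using x by (auto simp: weights_of_def PiE_def)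
  next
    fix k assume k: "k \<in> {1..N}"
    show "x k = weights_of N mu J k"
      unfolding J_def weights_of_hatJ_mat[OF N k] using xk k by simp
  qed
  ultimately show "\<exists>J\<in>positive_data N lam mu \<beta>. x = weights_of N mu J" by blast
qed

lemma sign_similar_iff:
  "(J, K) \<in> sign_similar n \<longleftrightarrow> J \<in> carrier_mat n n \<and> K \<in> carrier_mat n n \<and>
    (\<exists>s. (\<forall>i<n. s i \<in> {1, -1}) \<and> (\<forall>i<n. \<forall>j<n. K $$ (i, j) = s i * J $$ (i, j) * s j))"
proof -
  have conj: "mat_diag n s * J * mat_diag n s = mat n n (\<lambda>(i, j). s i * J $$ (i, j) * s j)"
    if "J \<in> carrier_mat n n" for s
  proof -
    have "mat_diag n s * J \<in> carrier_mat n n"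
      by (rule mult_carrier_mat[OF mat_diag_dim that])
    from mat_diag_mult_right[OF this, of s] show ?thesis
      using that by (auto simp: mat_diag_mult_left intro!: eq_matI)
  qed
  have entries: "K = mat n n (\<lambda>(i, j). s i * J $$ (i, j) * s j) \<longleftrightarrow>
      K \<in> carrier_mat n n \<and> (\<forall>i<n. \<forall>j<n. K $$ (i, j) = s i * J $$ (i, j) * s j)" for s
    by (auto intro!: eq_matI)
  have "(J, K) \<in> sign_similar n \<longleftrightarrow> J \<in> carrier_mat n n \<and>
      (\<exists>s. (\<forall>i<n. s i \<in> {1, -1}) \<and> K = mat_diag n s * J * mat_diag n s)"
    by (simp only: sign_similar_def mem_Collect_eq case_prod_conv)
  also have "\<dots> \<longleftrightarrow> J \<in> carrier_mat n n \<and>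
      (\<exists>s. (\<forall>i<n. s i \<in> {1, -1}) \<and> K = mat n n (\<lambda>(i, j). s i * J $$ (i, j) * s j))"
    by (simp only: conj cong: conj_cong)
  also have "\<dots> \<longleftrightarrow> J \<in> carrier_mat n n \<and> K \<in> carrier_mat n n \<and>
    (\<exists>s. (\<forall>i<n. s i \<in> {1, -1}) \<and> (\<forall>i<n. \<forall>j<n. K $$ (i, j) = s i * J $$ (i, j) * s j))"
    unfolding entries by blast
  finally show ?thesis .
qed

lemma sign_similar_refl: "J \<in> carrier_mat n n \<Longrightarrow> (J, J) \<in> sign_similar n"
  unfolding sign_similar_iff by (auto intro!: exI[of _ "\<lambda>_. 1"])

lemma sign_similar_sym:
  assumes "(J, K) \<in> sign_similar n" shows "(K, J) \<in> sign_similar n"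
proof -
  obtain s where c: "J \<in> carrier_mat n n" "K \<in> carrier_mat n n" and s: "\<forall>i<n. s i \<in> {1, -1}"
    and K: "\<forall>i<n. \<forall>j<n. K $$ (i, j) = s i * J $$ (i, j) * s j"
    using assms unfolding sign_similar_iff by blast
  have "J $$ (i, j) = s i * K $$ (i, j) * s j" if "i < n" "j < n" for i j
  proof -
    have "s i \<in> {1, - 1}" "s j \<in> {1, - 1}" using s that by blast+
    then have "s i * s i = 1" "s j * s j = 1" by auto
    then have "J $$ (i, j) = (s i * s i) * J $$ (i, j) * (s j * s j)" by simp
    also have "\<dots> = s i * K $$ (i, j) * s j" using K that by (simp only: mult_ac)
    finally show ?thesis .
  qed
  then show ?thesis unfolding sign_similar_iff using c s by blast
qed

lemma sign_similar_trans:
  assumes "(J, K) \<in> sign_similar n" "(K, L) \<in> sign_similar n" shows "(J, L) \<in> sign_similar n"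
proof -
  obtain s where c: "J \<in> carrier_mat n n" and s: "\<forall>i<n. s i \<in> {1, -1}"
    and K: "\<forall>i<n. \<forall>j<n. K $$ (i, j) = s i * J $$ (i, j) * s j"
    using assms(1) unfolding sign_similar_iff by blast
  obtain s' where c': "L \<in> carrier_mat n n" and s': "\<forall>i<n. s' i \<in> {1, -1}"
    and L: "\<forall>i<n. \<forall>j<n. L $$ (i, j) = s' i * K $$ (i, j) * s' j"
    using assms(2) unfolding sign_similar_iff by blast
  have "s i * s' i \<in> {1, -1}" if "i < n" for i
  proof -
    have "s i \<in> {1, - 1}" "s' i \<in> {1, - 1}" using s s' that by blast+
    then show ?thesis by auto
  qed
  moreover have "\<forall>i<n. \<forall>j<n. L $$ (i, j) = (s i * s' i) * J $$ (i, j) * (s j * s' j)"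
    using K L by (simp add: mult_ac)
  ultimately show ?thesis unfolding sign_similar_iff using c c'
    by (intro conjI exI[of _ "\<lambda>i. s i * s' i"]) auto
qed

lemma sign_similar_class_eq_iff:
  assumes "J \<in> carrier_mat n n" "K \<in> carrier_mat n n"
  shows "sign_similar n `` {J} = sign_similar n `` {K} \<longleftrightarrow> (J, K) \<in> sign_similar n"
  using assms sign_similar_refl[of K n] sign_similar_sym sign_similar_trans by blast

text \<open>
  Conjugation by \<open>s i = sgn (b\<^sub>1 \<dots> b\<^sub>i)\<close> replaces \<open>b\<^sub>1, \<dots>, b\<^sub>N\<close> by their absolute values and
  multiplies the corner entry by the product of all their signs, so the product of all
  parameters is unchanged.
\<close>
lemma ex_positive_representative:
  assumes N: "N \<ge> 2" and mu: "inj_on mu {1..N}" and \<beta>: "\<beta> \<noteq> 0"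
    and J: "J \<in> hatJ_data (Suc N) lam mu \<beta>"
  shows "\<exists>K\<in>positive_data N lam mu \<beta>. (J, K) \<in> sign_similar (Suc N)"
proof -
  let ?a = "corner_entry N lam mu"
  obtain c b r where J_eq: "J = hatJ_mat (Suc N) c b ?a (of_real r)"
      and adm: "admissible N lam mu \<beta> c b r"
    using hatJ_data_cases[OF N mu \<beta> J] by blast
  have b: "\<forall>k\<in>{1..N}. b k \<noteq> 0"
    using adm \<beta> by (auto simp: admissible_def)
  define s where "s i = (\<Prod>l=1..i. sgn (b l))" for i
  have s_Suc: "s (Suc i) = s i * sgn (b (Suc i))" and s_0: "s 0 = 1" for i
    by (simp_all add: s_def)
  have s1: "s i \<in> {1, - 1}" if "i \<le> N" for i
    using that b by (induction i) (auto simp: s_Suc s_0 sgn_if)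
  have ss: "s i * s i = 1" if "i \<le> N" for i
    using s1[OF that] by auto
  have s_b: "s i * b (Suc i) * s (Suc i) = \<bar>b (Suc i)\<bar>" if "i < N" for i
    using ss[of i] that by (simp add: s_Suc abs_sgn mult_ac flip: mult.assoc[of "s i" "s i"])
  define r' where "r' = r * s N"
  define K where "K = hatJ_mat (Suc N) c (\<lambda>k. \<bar>b k\<bar>) ?a (of_real r')"
  have "s N * (\<Prod>k=1..N. \<bar>b k\<bar>) = (\<Prod>k=1..N. b k)"
    unfolding s_def prod.distrib[symmetric] by (rule prod.cong) (auto simp: sgn_mult_abs)
  then have "r' * (\<Prod>k=1..N. \<bar>b k\<bar>) = \<beta>"
    using adm by (simp add: r'_def admissible_def mult.assoc)
  moreover have "r'\<^sup>2 = r\<^sup>2"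
    using ss[of N] by (simp add: r'_def power2_eq_square mult_ac flip: mult.assoc[of "s N" "s N"])
  moreover have "jacobi_poly c (\<lambda>k. \<bar>b k\<bar>) i m = jacobi_poly c b i m" for i m
    by (rule jacobi_poly_cong) auto
  ultimately have "admissible N lam mu \<beta> c (\<lambda>k. \<bar>b k\<bar>) r'"
    using adm by (simp add: admissible_def)
  then have "K \<in> positive_data N lam mu \<beta>"
    using b N by (auto simp: K_def positive_data_def hatJ_mat_mem_hatJ_data_iff[OF N mu \<beta>] hat_b_hatJ_mat)
  moreover have "(J, K) \<in> sign_similar (Suc N)"
    unfolding sign_similar_iff
  proof (intro conjI exI[of _ "\<lambda>i. of_real (s i)"] allI impI)
    show "J \<in> carrier_mat (Suc N) (Suc N)" "K \<in> carrier_mat (Suc N) (Suc N)"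
      by (simp_all add: J_eq K_def hatJ_mat_def)
    show "complex_of_real (s i) \<in> {1, - 1}" if "i < Suc N" for i
      using s1[of i] that by auto
    fix i j assume ij: "i < Suc N" "j < Suc N"
    have diag: "of_real (s i) * z * of_real (s i) = z" if "i \<le> N" for i and z :: complex
      using s1[OF that] by auto
    have super: "of_real (s i) * of_real (b (Suc i)) * of_real (s (Suc i)) = complex_of_real \<bar>b (Suc i)\<bar>"
      if "i < N" for i
      unfolding s_b[OF that, symmetric] by simp
    have sub: "of_real (s (Suc i)) * of_real (b (Suc i)) * of_real (s i) = complex_of_real \<bar>b (Suc i)\<bar>"
      if "i < N" for i
      unfolding super[OF that, symmetric] by (simp only: mult_ac)
    consider "i = j" | "j = Suc i" | "i = Suc j" | "i = 0" "j = N" | "i = N" "j = 0"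
      | "i \<noteq> j" "j \<noteq> Suc i" "i \<noteq> Suc j" "\<not> (i = 0 \<and> j = N)" "\<not> (i = N \<and> j = 0)"
      by blast
    then show "K $$ (i, j) = complex_of_real (s i) * J $$ (i, j) * complex_of_real (s j)"
    proof cases
      case 1
      then show ?thesis using ij N by (simp add: K_def J_eq hatJ_mat_def diag)
    next
      case 2
      then show ?thesis using ij N by (simp add: K_def J_eq hatJ_mat_def super)
    next
      case 3
      then show ?thesis using ij N by (simp add: K_def J_eq hatJ_mat_def sub)
    next
      case 4
      then show ?thesis using ij N by (simp add: K_def J_eq hatJ_mat_def s_0 r'_def)
    next
      case 5
      then show ?thesis using ij N by (simp add: K_def J_eq hatJ_mat_def s_0 r'_def mult.commute)
    next
      case 6
      then show ?thesis using ij by (auto simp: K_def J_eq hatJ_mat_def)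
    qed
  qed
  ultimately show ?thesis by blast
qed

text \<open>
  If \<open>b\<^sub>i\<^sub>+\<^sub>1\<close> stays positive, then neighbouring signs agree; hence all signs agree and the
  conjugation is trivial.
\<close>
lemma positive_representative_unique:
  assumes N: "N \<ge> 2" and mu: "inj_on mu {1..N}" and \<beta>: "\<beta> \<noteq> 0"
    and J: "J \<in> positive_data N lam mu \<beta>" and K: "K \<in> positive_data N lam mu \<beta>"
    and sim: "(J, K) \<in> sign_similar (Suc N)"
  shows "J = K"
proof -
  obtain s where J': "J \<in> carrier_mat (Suc N) (Suc N)" and K': "K \<in> carrier_mat (Suc N) (Suc N)"
    and s: "\<forall>i<Suc N. s i \<in> {1, -1}"
    and eq: "\<forall>i<Suc N. \<forall>j<Suc N. K $$ (i, j) = s i * J $$ (i, j) * s j"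
    using sim unfolding sign_similar_iff by blast
  have s0: "s i = s 0" if "i \<le> N" for i
    using that
  proof (induction i)
    case (Suc i)
    have i: "i < Suc N" "Suc i < Suc N" using Suc.prems by auto
    have "Re (J $$ (i, Suc i)) > 0" "Re (K $$ (i, Suc i)) > 0"
      using J K J' K' Suc.prems by (auto simp: positive_data_def hat_b_def dest!: bspec[of _ _ "Suc i"])
    moreover have "K $$ (i, Suc i) = s i * J $$ (i, Suc i) * s (Suc i)"
      using eq i by blast
    ultimately have "s (Suc i) = s i"
      using s[rule_format, OF i(1)] s[rule_format, OF i(2)] by auto
    then show ?case using Suc by simp
  qed simp
  show ?thesis
  proof (rule eq_matI)
    fix i j assume "i < dim_row K" "j < dim_col K"
    then have ij: "i < Suc N" "j < Suc N" using K' by auto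
    then have "s i = s 0" "s j = s 0" using s0[of i] s0[of j] by auto
    moreover have "s 0 * s 0 = 1" using s by fastforce
    moreover have "K $$ (i, j) = s i * J $$ (i, j) * s j"
      using eq ij by blast
    ultimately show "J $$ (i, j) = K $$ (i, j)" by (simp add: mult_ac flip: mult.assoc[of "s 0" "s 0"])
  qed (use J' K' in auto)
qed

lemma bij_betw_sign_similar_classes:
  assumes N: "N \<ge> 2" and mu: "inj_on mu {1..N}" and \<beta>: "\<beta> \<noteq> 0"
  shows "bij_betw (\<lambda>J. sign_similar (Suc N) `` {J}) (positive_data N lam mu \<beta>)
    (hatJ_data (Suc N) lam mu \<beta> // sign_similar (Suc N))"
proof (rule bij_betw_imageI)
  have carrier: "J \<in> carrier_mat (Suc N) (Suc N)" if "J \<in> hatJ_data (Suc N) lam mu \<beta>" for J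
    using that by (auto simp: hatJ_data_def hatJ_class_def hatJ_mat_def)
  have sub: "positive_data N lam mu \<beta> \<subseteq> hatJ_data (Suc N) lam mu \<beta>"
    by (auto simp: positive_data_def)
  show "inj_on (\<lambda>J. sign_similar (Suc N) `` {J}) (positive_data N lam mu \<beta>)"
    using sub carrier sign_similar_class_eq_iff positive_representative_unique[OF N mu \<beta>]
    by (intro inj_onI) blast
  show "(\<lambda>J. sign_similar (Suc N) `` {J}) ` positive_data N lam mu \<beta>
      = hatJ_data (Suc N) lam mu \<beta> // sign_similar (Suc N)"
  proof (intro equalityI subsetI)
    fix C assume "C \<in> hatJ_data (Suc N) lam mu \<beta> // sign_similar (Suc N)"
    then obtain J where J: "J \<in> hatJ_data (Suc N) lam mu \<beta>" "C = sign_similar (Suc N) `` {J}"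
      by (auto simp: quotient_def)
    obtain K where K: "K \<in> positive_data N lam mu \<beta>" "(J, K) \<in> sign_similar (Suc N)"
      using ex_positive_representative[OF N mu \<beta> J(1)] by blast
    then have "C = sign_similar (Suc N) `` {K}"
      using J sub carrier sign_similar_class_eq_iff by blast
    then show "C \<in> (\<lambda>J. sign_similar (Suc N) `` {J}) ` positive_data N lam mu \<beta>"
      using K by blast
  qed (use sub in \<open>auto simp: quotient_def\<close>)
qed

section \<open>The inverse spectral theorem\<close>

theorem theorem4p4:
  fixes n :: nat and \<beta> :: real and mu :: "nat \<Rightarrow> real" and lam :: "nat \<Rightarrow> complex"
  assumes "n \<ge> 3"
    and "\<beta> \<noteq> 0"
    and "strict_mono_on {1..n-1} mu"
    and "\<forall>j\<in>{1..n}. Im (lam j) \<ge> 0"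
  defines "cond_i \<equiv> \<forall>k\<in>{1..n-1}. chi n lam (mu k) \<in> \<real> \<and> (-1) ^ (n - k) * Re (chi n lam (mu k)) \<ge> 0"
    and "cond_ii \<equiv> \<forall>k\<in>{1..n-1}. cmod (chi n lam (mu k)) \<ge> 4 * (-1) ^ (n - k - 1) * \<beta>"
    and "m1 \<equiv> card {k\<in>{1..n-1}. (-1) ^ (n - k) * chi n lam (mu k) = 0}"
    and "m2 \<equiv> card {k\<in>{1..n-1}. cmod (chi n lam (mu k)) = 4 * (-1) ^ (n - k - 1) * \<beta>}"
  shows "((\<exists>J\<in>hatJ_data n lam mu \<beta>. Im (hat_a J) > 0) \<longleftrightarrow>
            (\<exists>j\<in>{1..n}. Im (lam j) > 0) \<and> cond_i \<and> cond_ii) \<and>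
         (cond_i \<and> cond_ii \<longrightarrow>
            m1 + m2 \<le> n - 1 \<and>
            card (hatJ_data n lam mu \<beta> // sign_similar n) = 2 ^ (n - m1 - m2 - 1) \<and>
            card {J \<in> hatJ_data n lam mu \<beta>. \<forall>k\<in>{1..n-1}. Re (hat_b J k) > 0} = 2 ^ (n - m1 - m2 - 1))"
proof -
  define N where "N = n - 1"
  have N: "N \<ge> 2" and n: "n = Suc N"
    using assms(1) by (auto simp: N_def)
  have mu: "strict_mono_on {1..N} mu" using assms(3) by (simp add: N_def)
  note \<beta> = assms(2) and inj = strict_mono_on_imp_inj_on[OF mu]
  define nw where "nw = node_weights N lam mu \<beta>"
  define M1 where "M1 = {k\<in>{1..N}. chi n lam (mu k) = 0}"
  define M2 where "M2 = {k\<in>{1..N}. cmod (chi n lam (mu k)) = 4 * (-1) ^ (n - k - 1) * \<beta>}"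
  have m: "m1 = card M1" "m2 = card M2"
    unfolding m1_def m2_def M1_def M2_def N_def by (auto intro!: arg_cong[of _ _ card])
  \<comment> \<open>a node with both equalities would force \<open>\<beta> = 0\<close>\<close>
  have "M1 \<inter> M2 = {}" using \<beta> by (auto simp: M1_def M2_def)
  moreover have M_sub: "M1 \<union> M2 \<subseteq> {1..N}" by (auto simp: M1_def M2_def)
  moreover from this have fin: "finite M1" "finite M2" by (auto dest: finite_subset)
  ultimately have card_M: "card (M1 \<union> M2) = m1 + m2"
    unfolding m by (simp add: card_Un_disjoint)
  have bij: "bij_betw (weights_of N mu) (positive_data N lam mu \<beta>) (PiE {1..N} nw)"
    unfolding nw_def by (rule bij_betw_weights_of[OF N mu \<beta>])
  have count: "m1 + m2 \<le> N \<and> card (positive_data N lam mu \<beta>) = 2 ^ (N - (m1 + m2))"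
    if "cond_i" "cond_ii"
  proof
    show "m1 + m2 \<le> N" using card_mono[OF _ M_sub] card_M by simp
    have card_nw: "card (nw k) = (if k \<in> M1 \<union> M2 then 1 else 2)" if k: "k \<in> {1..N}" for k
      using node_weights_count(2)[OF \<beta> k, of lam mu] \<open>cond_i\<close> \<open>cond_ii\<close> k
      unfolding cond_i_def cond_ii_def N_def[symmetric] M1_def M2_def nw_def n by simp
    have prod_if: "(\<Prod>k=1..N. if k \<in> M then 1 else 2) = (2 :: nat) ^ card ({1..N} - M)" for M
      by (simp add: prod.If_cases Diff_eq)
    have "card (positive_data N lam mu \<beta>) = (\<Prod>k=1..N. card (nw k))"
      using bij_betw_same_card[OF bij] by (simp add: card_PiE)
    also have "\<dots> = (\<Prod>k=1..N. if k \<in> M1 \<union> M2 then 1 else 2)"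
      using card_nw by (intro prod.cong) auto
    also have "\<dots> = 2 ^ card ({1..N} - (M1 \<union> M2))"
      using prod_if[of "M1 \<union> M2"] .
    also have "card ({1..N} - (M1 \<union> M2)) = N - (m1 + m2)"
      using card_Diff_subset[OF _ M_sub] fin card_M by simp
    finally show "card (positive_data N lam mu \<beta>) = 2 ^ (N - (m1 + m2))" .
  qed
  have Im_a: "Im (hat_a J) > 0 \<longleftrightarrow> (\<exists>j\<in>{1..n}. Im (lam j) > 0)" if J: "J \<in> hatJ_data n lam mu \<beta>" for J
  proof -
    obtain c b r where "J = hatJ_mat (Suc N) c b (corner_entry N lam mu) (of_real r)"
      using hatJ_data_cases[OF N inj \<beta> J[unfolded n]] by blast
    then have "hat_a J = corner_entry N lam mu"
      using hat_a_hatJ_mat[OF assms(1)] by (simp add: n)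
    then have "Im (hat_a J) = (\<Sum>j=1..n. Im (lam j))"
      unfolding n by (simp add: corner_entry_def)
    moreover have "(\<Sum>j=1..n. Im (lam j)) = 0 \<longleftrightarrow> (\<forall>j\<in>{1..n}. Im (lam j) = 0)"
      using assms(4) by (intro sum_nonneg_eq_0_iff) auto
    moreover have "(\<Sum>j=1..n. Im (lam j)) \<ge> 0"
      using assms(4) by (intro sum_nonneg) auto
    ultimately show ?thesis using assms(4) by (metis order_le_less less_irrefl)
  qed
  have necessary: "cond_i \<and> cond_ii" if J: "J \<in> hatJ_data n lam mu \<beta>" for J
  proof -
    obtain c b r where "J = hatJ_mat (Suc N) c b (corner_entry N lam mu) (of_real r)"
        and adm: "admissible N lam mu \<beta> c b r"
      by (rule hatJ_data_cases[OF N inj \<beta> J[unfolded n]])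
    show ?thesis
      unfolding cond_i_def cond_ii_def n diff_Suc_1
      using node_weights_count(1)[OF \<beta> _ admissible_node_weights[OF N mu \<beta> adm]] by blast
  qed
  have sufficient: "hatJ_data n lam mu \<beta> \<noteq> {}" if "cond_i" "cond_ii"
  proof -
    have "card (positive_data N lam mu \<beta>) \<noteq> 0" using count[OF that] by simp
    then have "positive_data N lam mu \<beta> \<noteq> {}" by auto
    then show ?thesis by (auto simp: positive_data_def n)
  qed
  have pos: "{J \<in> hatJ_data n lam mu \<beta>. \<forall>k\<in>{1..N}. Re (hat_b J k) > 0} = positive_data N lam mu \<beta>"
    by (simp add: positive_data_def n)
  have quot: "card (hatJ_data n lam mu \<beta> // sign_similar n) = card (positive_data N lam mu \<beta>)"
    using bij_betw_same_card[OF bij_betw_sign_similar_classes[OF N inj \<beta>]] by (simp add: n)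
  have "N - (m1 + m2) = n - m1 - m2 - 1" by (simp add: n)
  then show ?thesis
    unfolding N_def[symmetric] pos quot using count Im_a necessary sufficient by auto
qed

end
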